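(* Consider the parametrized nonlinear program $\min_x f(x,\xi)$ subject to $h(x,\xi)=0$, $g(x,\xi)\le 0$, with $f:\mathbb{R}^n\times\Xi\to\mathbb{R}$, $h:\mathbb{R}^n\times\Xi\to\mathbb{R}^p$, $g:\mathbb{R}^n\times\Xi\to\mathbb{R}^m$ twice continuously differentiable in $(x,\xi)$ and $\Xi\subset\mathbb{R}^r$. Let $\bar x^\star$ be a regular minimizer for $\bar\xi\in\Xi$ with multiplier $(\bar\lambda^\star,\bar\mu^\star)$, and let $x^\star,\lambda^\star,\mu^\star$ be the associated continuous local solution and multiplier maps around $\bar\xi$ (see context). Assume that strict complementary slackness holds at $(\bar x^\star,\bar\lambda^\star,\bar\mu^\star)$ and that $A(\bar\xi)$ is positive definite. Then, in a neighborhood $\mathcal{N}\subset\Xi$ of $\bar\xi$, the maps $x^\star:\mathcal{N}\to\mathbb{R}^n$ and $(\lambda^\star,\mu^\star):\mathcal{N}\to\mathbb{R}^p\times\mathbb{R}^m_{\ge0}$ are continuously differentiable with $$\nabla_\xi x^\star=-\Pi A^{-1}L^\star-\Sigma B^\dagger G^\star\in\mathbb{R}^{n\times r},$$ $$\nabla_\xi\begin{bmatrix}\lambda^\star\\ \mu^\star_{\mathbf{I}^\star}\end{bmatrix}=-(B^\dagger)^\top A\,\Sigma\left(A^{-1}L^\star-B^\dagger G^\star\right)\in\mathbb{R}^{(p+|\mathbf{I}^\star|)\times r},$$ and $\nabla_\xi\mu^\star_{\bar{\mathbf{I}}^\star}=0$, where all quantities are evaluated at $\xi\in\mathcal N$,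 $B^\dagger:=B^\top(BB^\top)^{-1}\in\mathbb{R}^{n\times(p+|\mathbf{I}^\star|)}$ is the pseudoinverse of $B$, and $\Sigma,\Pi\in\mathbb{R}^{n\times n}$ are $$\Sigma:=A^{-1}B^\top(BA^{-1}B^\top)^{-1}B,\qquad \Pi:=\mathbb{I}-\Sigma .$$ If the problem has only inequality constraints and none of them is active at $\bar\xi$, then $B^\dagger G^\star=0$ (and $\Sigma=0$, $\Pi=\mathbb{I}$).
   Context: Feasible set: $\mathcal{X}(\xi)=\{x: h(x,\xi)=0,\ g(x,\xi)\le0\}$. For $x\in\mathcal X(\xi)$ let $\mathbf{I}^\xi_x=\{i: g_i(x,\xi)=0\}$ (active inequality constraints) and $\bar{\mathbf{I}}^\xi_x=\{i: g_i(x,\xi)<0\}$ (inactive ones). For an index set $\mathbf I$, $v_{\mathbf I}$ is the subvector of $v$ with indices in $\mathbf I$. Lagrangian: $L(x,\lambda,\mu,\xi)=f(x,\xi)+\lambda^\top h(x,\xi)+\mu^\top g(x,\xi)$. LICQ at $x$: the gradients with respect to $x$ of all components of $h$ and of all active $g_i$, $i\in\mathbf I_x^\xi$, are linearly independent. KKT at $(x,\lambda,\mu)\in\mathcal X(\xi)\times\mathbb R^p\times\mathbb R^m_{\ge0}$: $\nabla_xL=0$ and $\mu_i=0$ for all $i\in\bar{\mathbf I}^\xi_x$. Strong second-order sufficiency condition (SSOSC): $y^\top\nabla^2_{xx}L\,y>0$ for all $y\ne0$ with $\nabla_xh(x,\xi)y=0$ and $\nabla_xg_i(x,\xi)y=0$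 for all $i$ with $\mu_i>0$. A regular minimizer is a point $x$ with multiplier $(\lambda,\mu)$ satisfying LICQ, KKT and SSOSC. Strict complementary slackness (SCS): $\mu_i>0$ for every active inequality constraint $i\in\mathbf I^\xi_x$. Local solution maps: by a classical sensitivity theorem, on a neighborhood $\mathcal{N}_0\subset\Xi$ of $\bar\xi$ there are continuous maps $x^\star:\mathcal N_0\to\mathbb R^n$, $\lambda^\star:\mathcal N_0\to\mathbb R^p$, $\mu^\star:\mathcal N_0\to\mathbb R^m_{\ge0}$ with $(x^\star,\lambda^\star,\mu^\star)(\bar\xi)=(\bar x^\star,\bar\lambda^\star,\bar\mu^\star)$ such that for all $\xi\in\mathcal N_0$ LICQ holds at $x^\star(\xi)$, KKT and SSOSC hold at $(x^\star(\xi),\lambda^\star(\xi),\mu^\star(\xi))$, and $x^\star(\xi)$ is a local minimizer with multiplier $(\lambda^\star(\xi),\mu^\star(\xi))$. The maps in the claim are these (with $\mathcal N\subset\mathcal N_0$). Notation: $\mathbf I^\star(\xi)=\mathbf I^\xi_{x^\star(\xi)}$, $\bar{\mathbf I}^\star(\xi)=\bar{\mathbf I}^\xi_{x^\star(\xi)}$; $A(\xi)=\nabla^2_{xx}L$ ($n\times n$), $L^\star(\xi)=\nabla^2_{\xi x}L$ ($n\times r$, the Jacobian with respect to $\xi$ of the column gradient of $L$ with respect to $x$), both evaluated at $(x^\star(\xi),\lambda^\star(\xi),\mu^\star(\xi),\xi)$; $B(\xi)=\begin{bmatrix}\nabla_xh\\ \nabla_xg_{\mathbf I^\star(\xi)}\end{bmatrix}$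 and $G^\star(\xi)=\begin{bmatrix}\nabla_\xi h\\ \nabla_\xi g_{\mathbf I^\star(\xi)}\end{bmatrix}$ evaluated at $(x^\star(\xi),\xi)$. If there are no equality constraints and $\mathbf I^\star(\xi)=\emptyset$, the convention is $B(\xi)=0$, $G^\star(\xi)=0$. $\mathbb I$ is the identity matrix. *)

theory Defs
  imports
    "HOL-Analysis.Analysis"
    "Jordan_Normal_Form.Gauss_Jordan_Elimination"
begin

no_notation vec_index (infixl \<open>$\<close> 100)
no_notation scalar_prod (infix \<open>\<bullet>\<close> 70)

section \<open>Differentiability\<close>

definition C1_on :: "'a::real_normed_vector set \<Rightarrow> ('a \<Rightarrow> 'b::real_normed_vector) \<Rightarrow> bool" where
  "C1_on S f \<longleftrightarrow> (\<exists>f'. (\<forall>z\<in>S. (f has_derivative blinfun_apply (f' z)) (at z within S))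
                    \<and> continuous_on S f')"

definition C2_on :: "'a::real_normed_vector set \<Rightarrow> ('a \<Rightarrow> 'b::real_normed_vector) \<Rightarrow> bool" where
  "C2_on S f \<longleftrightarrow> (\<exists>f'. (\<forall>z\<in>S. (f has_derivative blinfun_apply (f' z)) (at z within S))
                    \<and> C1_on S f')"

definition grad :: "(real^'a \<Rightarrow> real) \<Rightarrow> real^'a \<Rightarrow> real^'a" where
  "grad \<phi> z = (\<chi> i. frechet_derivative \<phi> (at z) (axis i 1))"

definition pos_def :: "real^'a^'a \<Rightarrow> bool" where
  "pos_def M \<longleftrightarrow> (\<forall>y. y \<noteq> 0 \<longrightarrow> y \<bullet> (M *v y) > 0)"


section \<open>The parametrized program\<close>

text \<open>
  The constraint maps are given by their components \<open>h k\<close> for \<open>k < p\<close> and \<open>g i\<close> for \<open>i < m\<close>,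
  and the multipliers by \<open>lam k\<close> for \<open>k < p\<close> and \<open>mu i\<close> for \<open>i < m\<close>; other indices are never
  used. In this way \<open>p = 0\<close> (no equality constraints) and \<open>m = 0\<close> are allowed.
\<close>

type_synonym ('n, 'r) family = "nat \<Rightarrow> real^'n \<Rightarrow> real^'r \<Rightarrow> real"

definition feasible ::
  "nat \<Rightarrow> ('n::finite, 'r::finite) family \<Rightarrow> nat \<Rightarrow> ('n, 'r) family \<Rightarrow> real^'r \<Rightarrow> (real^'n) set" where
  "feasible p h m g \<xi> = {x. (\<forall>k<p. h k x \<xi> = 0) \<and> (\<forall>i<m. g i x \<xi> \<le> 0)}"

definition active ::
  "nat \<Rightarrow> ('n::finite, 'r::finite) family \<Rightarrow> real^'n \<Rightarrow> real^'r \<Rightarrow> nat set" where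
  "active m g x \<xi> = {i. i < m \<and> g i x \<xi> = 0}"

definition inactive ::
  "nat \<Rightarrow> ('n::finite, 'r::finite) family \<Rightarrow> real^'n \<Rightarrow> real^'r \<Rightarrow> nat set" where
  "inactive m g x \<xi> = {i. i < m \<and> g i x \<xi> < 0}"

definition lagrangian ::
  "(real^'n::finite \<Rightarrow> real^'r::finite \<Rightarrow> real) \<Rightarrow> nat \<Rightarrow> ('n, 'r) family \<Rightarrow> nat \<Rightarrow> ('n, 'r) family \<Rightarrow>
   real^'n \<Rightarrow> (nat \<Rightarrow> real) \<Rightarrow> (nat \<Rightarrow> real) \<Rightarrow> real^'r \<Rightarrow> real" where
  "lagrangian f p h m g x lam mu \<xi> =
     f x \<xi> + (\<Sum>k<p. lam k * h k x \<xi>) + (\<Sum>i<m. mu i * g i x \<xi>)"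

definition grad_x_lagrangian ::
  "(real^'n::finite \<Rightarrow> real^'r::finite \<Rightarrow> real) \<Rightarrow> nat \<Rightarrow> ('n, 'r) family \<Rightarrow> nat \<Rightarrow> ('n, 'r) family \<Rightarrow>
   real^'n \<Rightarrow> (nat \<Rightarrow> real) \<Rightarrow> (nat \<Rightarrow> real) \<Rightarrow> real^'r \<Rightarrow> real^'n" where
  "grad_x_lagrangian f p h m g x lam mu \<xi> = grad (\<lambda>x. lagrangian f p h m g x lam mu \<xi>) x"

definition hess_xx_lagrangian ::
  "(real^'n::finite \<Rightarrow> real^'r::finite \<Rightarrow> real) \<Rightarrow> nat \<Rightarrow> ('n, 'r) family \<Rightarrow> nat \<Rightarrow> ('n, 'r) family \<Rightarrow>
   real^'n \<Rightarrow> (nat \<Rightarrow> real) \<Rightarrow> (nat \<Rightarrow> real) \<Rightarrow> real^'r \<Rightarrow> real^'n^'n" where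
  "hess_xx_lagrangian f p h m g x lam mu \<xi> =
     jacobian (\<lambda>x. grad_x_lagrangian f p h m g x lam mu \<xi>) (at x)"

definition hess_\<xi>x_lagrangian ::
  "(real^'n::finite \<Rightarrow> real^'r::finite \<Rightarrow> real) \<Rightarrow> nat \<Rightarrow> ('n, 'r) family \<Rightarrow> nat \<Rightarrow> ('n, 'r) family \<Rightarrow>
   real^'n \<Rightarrow> (nat \<Rightarrow> real) \<Rightarrow> (nat \<Rightarrow> real) \<Rightarrow> real^'r \<Rightarrow> real^'r^'n" where
  "hess_\<xi>x_lagrangian f p h m g x lam mu \<xi> =
     jacobian (\<lambda>\<xi>. grad_x_lagrangian f p h m g x lam mu \<xi>) (at \<xi>)"

text \<open>
  LICQ concerns the indexed family of gradients (equality constraints tagged by \<open>Inl\<close>,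
  inequality constraints by \<open>Inr\<close>). A repeated gradient makes the family dependent although it
  leaves the set of gradients unchanged, hence the injectivity condition.
\<close>

definition licq ::
  "nat \<Rightarrow> ('n::finite, 'r::finite) family \<Rightarrow> nat \<Rightarrow> ('n, 'r) family \<Rightarrow> real^'n \<Rightarrow> real^'r \<Rightarrow> bool" where
  "licq p h m g x \<xi> \<longleftrightarrow>
     (let v = case_sum (\<lambda>k. grad (\<lambda>x. h k x \<xi>) x) (\<lambda>i. grad (\<lambda>x. g i x \<xi>) x);
          J = {..<p} <+> active m g x \<xi>
      in inj_on v J \<and> independent (v ` J))"

definition kkt ::
  "(real^'n::finite \<Rightarrow> real^'r::finite \<Rightarrow> real) \<Rightarrow> nat \<Rightarrow> ('n, 'r) family \<Rightarrow> nat \<Rightarrow> ('n, 'r) family \<Rightarrow>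
   real^'n \<Rightarrow> (nat \<Rightarrow> real) \<Rightarrow> (nat \<Rightarrow> real) \<Rightarrow> real^'r \<Rightarrow> bool" where
  "kkt f p h m g x lam mu \<xi> \<longleftrightarrow>
     x \<in> feasible p h m g \<xi> \<and> (\<forall>i<m. mu i \<ge> 0) \<and>
     grad_x_lagrangian f p h m g x lam mu \<xi> = 0 \<and>
     (\<forall>i\<in>inactive m g x \<xi>. mu i = 0)"

definition ssosc ::
  "(real^'n::finite \<Rightarrow> real^'r::finite \<Rightarrow> real) \<Rightarrow> nat \<Rightarrow> ('n, 'r) family \<Rightarrow> nat \<Rightarrow> ('n, 'r) family \<Rightarrow>
   real^'n \<Rightarrow> (nat \<Rightarrow> real) \<Rightarrow> (nat \<Rightarrow> real) \<Rightarrow> real^'r \<Rightarrow> bool" where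
  "ssosc f p h m g x lam mu \<xi> \<longleftrightarrow>
     (\<forall>y. y \<noteq> 0 \<and> (\<forall>k<p. grad (\<lambda>x. h k x \<xi>) x \<bullet> y = 0) \<and>
          (\<forall>i<m. mu i > 0 \<longrightarrow> grad (\<lambda>x. g i x \<xi>) x \<bullet> y = 0)
        \<longrightarrow> y \<bullet> (hess_xx_lagrangian f p h m g x lam mu \<xi> *v y) > 0)"

definition regular_minimizer ::
  "(real^'n::finite \<Rightarrow> real^'r::finite \<Rightarrow> real) \<Rightarrow> nat \<Rightarrow> ('n, 'r) family \<Rightarrow> nat \<Rightarrow> ('n, 'r) family \<Rightarrow>
   real^'n \<Rightarrow> (nat \<Rightarrow> real) \<Rightarrow> (nat \<Rightarrow> real) \<Rightarrow> real^'r \<Rightarrow> bool" where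
  "regular_minimizer f p h m g x lam mu \<xi> \<longleftrightarrow>
     licq p h m g x \<xi> \<and> kkt f p h m g x lam mu \<xi> \<and> ssosc f p h m g x lam mu \<xi>"

definition strict_compl ::
  "nat \<Rightarrow> ('n::finite, 'r::finite) family \<Rightarrow> real^'n \<Rightarrow> (nat \<Rightarrow> real) \<Rightarrow> real^'r \<Rightarrow> bool" where
  "strict_compl m g x mu \<xi> \<longleftrightarrow> (\<forall>i\<in>active m g x \<xi>. mu i > 0)"

definition local_minimizer ::
  "(real^'n::finite \<Rightarrow> real^'r::finite \<Rightarrow> real) \<Rightarrow> nat \<Rightarrow> ('n, 'r) family \<Rightarrow> nat \<Rightarrow> ('n, 'r) family \<Rightarrow>
   real^'n \<Rightarrow> real^'r \<Rightarrow> bool" where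
  "local_minimizer f p h m g x \<xi> \<longleftrightarrow>
     x \<in> feasible p h m g \<xi> \<and>
     (\<exists>\<epsilon>>0. \<forall>y\<in>feasible p h m g \<xi>. dist y x < \<epsilon> \<longrightarrow> f x \<xi> \<le> f y \<xi>)"

definition local_solution_maps ::
  "(real^'n::finite \<Rightarrow> real^'r::finite \<Rightarrow> real) \<Rightarrow> nat \<Rightarrow> ('n, 'r) family \<Rightarrow> nat \<Rightarrow> ('n, 'r) family \<Rightarrow>
   (real^'r) set \<Rightarrow> (real^'r \<Rightarrow> real^'n) \<Rightarrow> (real^'r \<Rightarrow> nat \<Rightarrow> real) \<Rightarrow> (real^'r \<Rightarrow> nat \<Rightarrow> real) \<Rightarrow> bool" where
  "local_solution_maps f p h m g N xs lams mus \<longleftrightarrow>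
     continuous_on N xs \<and>
     (\<forall>k<p. continuous_on N (\<lambda>\<xi>. lams \<xi> k)) \<and>
     (\<forall>i<m. continuous_on N (\<lambda>\<xi>. mus \<xi> i)) \<and>
     (\<forall>\<xi>\<in>N. licq p h m g (xs \<xi>) \<xi> \<and>
             kkt f p h m g (xs \<xi>) (lams \<xi>) (mus \<xi>) \<xi> \<and>
             ssosc f p h m g (xs \<xi>) (lams \<xi>) (mus \<xi>) \<xi> \<and>
             local_minimizer f p h m g (xs \<xi>) \<xi>)"


section \<open>Matrices\<close>

text \<open>
  The number of rows of \<open>B\<close> and \<open>G\<close> depends on \<open>\<xi>\<close> and may be zero, so the matrix formulas are
  stated for matrices of type \<^typ>\<open>real mat\<close>, whose dimensions are part of the value.
  The coordinates of \<open>real^'a\<close> are enumerated by one fixed bijection from \<open>{..<CARD('a)}\<close>.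
\<close>

definition coord :: "nat \<Rightarrow> 'a::finite" where
  "coord = from_nat_into UNIV"

lemma bij_betw_coord: "bij_betw (coord :: nat \<Rightarrow> 'a::finite) {..<CARD('a)} UNIV"
  unfolding coord_def by (rule bij_betw_from_nat_into_finite) simp

definition to_mat :: "real^'c::finite^'a::finite \<Rightarrow> real mat" where
  "to_mat M = Matrix.mat CARD('a) CARD('c) (\<lambda>(i, j). M $ coord i $ coord j)"

definition mat_of_row_list :: "(real^'c::finite) list \<Rightarrow> real mat" where
  "mat_of_row_list vs = Matrix.mat (length vs) CARD('c) (\<lambda>(i, j). (vs ! i) $ coord j)"

text \<open>Meaningful for invertible matrices only; the \<open>0 \<times> 0\<close> matrix is its own inverse.\<close>

definition minv :: "real mat \<Rightarrow> real mat" where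
  "minv M = the (mat_inverse M)"

definition pinv :: "real mat \<Rightarrow> real mat" where
  "pinv B = B\<^sup>T * minv (B * B\<^sup>T)"

definition Sigma_mat :: "real mat \<Rightarrow> real mat \<Rightarrow> real mat" where
  "Sigma_mat A B = minv A * B\<^sup>T * minv (B * minv A * B\<^sup>T) * B"

definition Pi_mat :: "real mat \<Rightarrow> real mat \<Rightarrow> real mat" where
  "Pi_mat A B = 1\<^sub>m (dim_row A) - Sigma_mat A B"

text \<open>
  Rows: equality constraints first, then active inequality constraints in increasing order of
  index. With \<open>p = 0\<close> and no active constraint, these are the (zero) matrices without rows.
\<close>

definition constr_jac_x ::
  "nat \<Rightarrow> ('n::finite, 'r::finite) family \<Rightarrow> nat \<Rightarrow> ('n, 'r) family \<Rightarrow> real^'n \<Rightarrow> real^'r \<Rightarrow> real mat" where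
  "constr_jac_x p h m g x \<xi> = mat_of_row_list
     (map (\<lambda>k. grad (\<lambda>x. h k x \<xi>) x) [0..<p] @
      map (\<lambda>i. grad (\<lambda>x. g i x \<xi>) x) (sorted_list_of_set (active m g x \<xi>)))"

definition constr_jac_\<xi> ::
  "nat \<Rightarrow> ('n::finite, 'r::finite) family \<Rightarrow> nat \<Rightarrow> ('n, 'r) family \<Rightarrow> real^'n \<Rightarrow> real^'r \<Rightarrow> real mat" where
  "constr_jac_\<xi> p h m g x \<xi> = mat_of_row_list
     (map (\<lambda>k. grad (\<lambda>\<xi>. h k x \<xi>) \<xi>) [0..<p] @
      map (\<lambda>i. grad (\<lambda>\<xi>. g i x \<xi>) \<xi>) (sorted_list_of_set (active m g x \<xi>)))"

text \<open>The Jacobian of \<open>\<xi> \<mapsto> (lams \<xi>, (mus \<xi>)\<^sub>I)\<close>, the index set \<open>I\<close> being held fixed.\<close>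

definition mult_jac ::
  "nat \<Rightarrow> nat set \<Rightarrow> (real^'r::finite \<Rightarrow> nat \<Rightarrow> real) \<Rightarrow> (real^'r \<Rightarrow> nat \<Rightarrow> real) \<Rightarrow> real^'r \<Rightarrow> real mat" where
  "mult_jac p I lams mus \<xi> = mat_of_row_list
     (map (\<lambda>k. grad (\<lambda>\<xi>. lams \<xi> k) \<xi>) [0..<p] @
      map (\<lambda>i. grad (\<lambda>\<xi>. mus \<xi> i) \<xi>) (sorted_list_of_set I))"

end

theory Submission
  imports Defs "Jordan_Normal_Form.Determinant"
begin

(* The symbols $ and \<bullet> refer to the Euclidean spaces real^'n. *)
no_notation vec_index (infixl \<open>$\<close> 100)
no_notation scalar_prod (infix \<open>\<bullet>\<close> 70)

text \<open>
  Strict complementarity freezes the active set. Near the base point an active constraint keeps a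
  positive multiplier, so complementary slackness keeps it active, and an inactive constraint stays
  inactive by continuity. On a neighbourhood the branch \<open>(xs, lams, mus)\<close> therefore solves a
  square system of equations: the gradient of the Lagrangian vanishes, and so do the equality
  constraints and the inequality constraints of one fixed index set \<open>I\<close>. The multipliers outside
  \<open>I\<close> are constantly zero, which settles their gradients.

  The Jacobian of this system in the unknowns is the KKT matrix with blocks \<open>A\<close>, \<open>B\<^sup>T\<close>, \<open>B\<close>, \<open>0\<close>.
  It is injective: if \<open>A u + B\<^sup>T \<eta> = 0\<close> and \<open>B u = 0\<close>, then \<open>u \<bullet> A u = - (B u) \<bullet> \<eta> = 0\<close>, so \<open>u = 0\<close>
  since \<open>A\<close> is positive definite, and then \<open>\<eta> = 0\<close> since the rows of \<open>B\<close> are independent. Positive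
  definiteness is an open condition (\<open>positive_on_neighborhood\<close>), so this holds near the base point.

  A continuous branch of zeros of a continuously differentiable map is continuously differentiable
  as soon as the partial derivative in the unknown is injective (\<open>implicit_C1\<close>). The branch is given,
  so only its differentiability has to be shown, by a direct estimate with a left
  inverse of the partial derivative. Applied to the KKT system this yields \<open>kkt_branch_C1\<close>.

  Differentiating the system along the branch gives \<open>A X + B\<^sup>T V = - L\<close> and \<open>B X = - G\<close> for the
  Jacobians \<open>X\<close> of the minimizer and \<open>V\<close> of the multipliers (\<open>kkt_branch_derivative\<close>). Block
  elimination with the Schur complement \<open>B A\<^sup>-\<^sup>1 B\<^sup>T\<close> solves these two equations; rewriting the
  solution by means of \<open>B B\<^sup>\<dagger> = 1\<close> gives the stated formulas (\<open>kkt_system_solution\<close>).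
\<close>

section \<open>Calculus of continuously differentiable maps\<close>

lemma C1_onI:
  assumes "\<And>z. z \<in> S \<Longrightarrow> (f has_derivative blinfun_apply (f' z)) (at z within S)" "continuous_on S f'"
  shows "C1_on S f"
  using assms unfolding C1_on_def by blast

lemma C1_on_continuous_on: "C1_on S f \<Longrightarrow> continuous_on S f"
  unfolding C1_on_def continuous_on_eq_continuous_within
  by (metis has_derivative_continuous)

lemma C1_on_subset:
  assumes "C1_on T f" "S \<subseteq> T"
  shows "C1_on S f"
  using assms unfolding C1_on_def
  by (meson continuous_on_subset has_derivative_subset subsetD)

lemma C1_on_cong:
  assumes "C1_on S f" "\<And>z. z \<in> S \<Longrightarrow> f z = g z"
  shows "C1_on S g"
  using assms unfolding C1_on_def
  by (metis has_derivative_transform)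

lemma C1_on_bounded_linear:
  assumes "bounded_linear f"
  shows "C1_on S f"
  by (rule C1_onI[where f' = "\<lambda>_. Blinfun f"])
     (simp_all add: bounded_linear_Blinfun_apply assms bounded_linear_imp_has_derivative)

lemma C1_on_const: "C1_on S (\<lambda>_. c)"
  by (rule C1_onI[where f' = "\<lambda>_. 0"]) (auto simp: zero_blinfun.rep_eq)

lemma C1_on_compose:
  assumes "C1_on T g" "C1_on S f" "f ` S \<subseteq> T"
  shows "C1_on S (\<lambda>z. g (f z))"
proof -
  obtain g' where g: "\<And>y. y \<in> T \<Longrightarrow> (g has_derivative blinfun_apply (g' y)) (at y within T)"
    "continuous_on T g'" using assms(1) unfolding C1_on_def by blast
  obtain f' where f: "\<And>y. y \<in> S \<Longrightarrow> (f has_derivative blinfun_apply (f' y)) (at y within S)"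
    "continuous_on S f'" using assms(2) unfolding C1_on_def by blast
  show ?thesis
  proof (rule C1_onI[where f' = "\<lambda>z. g' (f z) o\<^sub>L f' z"])
    fix z assume z: "z \<in> S"
    have "(g has_derivative blinfun_apply (g' (f z))) (at (f z) within f ` S)"
      by (rule has_derivative_subset[OF g(1)]) (use z assms(3) in auto)
    from has_derivative_in_compose[OF f(1)[OF z] this]
    show "((\<lambda>z. g (f z)) has_derivative blinfun_apply (g' (f z) o\<^sub>L f' z)) (at z within S)"
      by (simp add: blinfun_compose.rep_eq o_def)
  next
    have "continuous_on S (\<lambda>z. g' (f z))"
      by (rule continuous_on_compose2[OF g(2) C1_on_continuous_on[OF assms(2)] assms(3)])
    then show "continuous_on S (\<lambda>z. g' (f z) o\<^sub>L f' z)"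
      by (intro continuous_intros f(2))
  qed
qed

lemma C1_on_Pair:
  fixes f :: "'a::real_normed_vector \<Rightarrow> 'b::real_normed_vector" and g :: "'a \<Rightarrow> 'c::real_normed_vector"
  assumes "C1_on S f" "C1_on S g"
  shows "C1_on S (\<lambda>z. (f z, g z))"
proof -
  obtain g' where g: "\<And>y. y \<in> S \<Longrightarrow> (g has_derivative blinfun_apply (g' y)) (at y within S)"
    "continuous_on S g'" using assms(2) unfolding C1_on_def by blast
  obtain f' where f: "\<And>y. y \<in> S \<Longrightarrow> (f has_derivative blinfun_apply (f' y)) (at y within S)"
    "continuous_on S f'" using assms(1) unfolding C1_on_def by blast
  have bl: "bounded_linear (\<lambda>x::'b. (x, 0::'c))" "bounded_linear (\<lambda>x::'c. (0::'b, x))"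
    by (auto intro!: bounded_linear_Pair bounded_linear_ident bounded_linear_zero)
  show ?thesis
    by (rule C1_onI[where f' = "\<lambda>z. (Blinfun (\<lambda>x. (x, 0)) o\<^sub>L f' z) + (Blinfun (\<lambda>x. (0, x)) o\<^sub>L g' z)"])
       (auto intro!: derivative_eq_intros f g continuous_intros
          simp: blinfun.bilinear_simps bounded_linear_Blinfun_apply bl)
qed

lemma C1_on_bounded_bilinear:
  assumes "bounded_bilinear pr" "C1_on S f" "C1_on S g"
  shows "C1_on S (\<lambda>z. pr (f z) (g z))"
proof -
  interpret bounded_bilinear pr by fact
  obtain g' where g: "\<And>y. y \<in> S \<Longrightarrow> (g has_derivative blinfun_apply (g' y)) (at y within S)"
    "continuous_on S g'" using assms(3) unfolding C1_on_def by blast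
  obtain f' where f: "\<And>y. y \<in> S \<Longrightarrow> (f has_derivative blinfun_apply (f' y)) (at y within S)"
    "continuous_on S f'" using assms(2) unfolding C1_on_def by blast
  show ?thesis
  proof (rule C1_onI[where f' = "\<lambda>z. (prod_right (f z) o\<^sub>L g' z) + (prod_left (g z) o\<^sub>L f' z)"])
    fix z assume z: "z \<in> S"
    show "((\<lambda>z. pr (f z) (g z)) has_derivative
        blinfun_apply ((prod_right (f z) o\<^sub>L g' z) + (prod_left (g z) o\<^sub>L f' z))) (at z within S)"
      using FDERIV[OF f(1)[OF z] g(1)[OF z]]
      by (simp add: blinfun.add_left plus_blinfun.rep_eq prod_right.rep_eq prod_left.rep_eq)
  next
    show "continuous_on S (\<lambda>z. (prod_right (f z) o\<^sub>L g' z) + (prod_left (g z) o\<^sub>L f' z))"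
      using C1_on_continuous_on[OF assms(2)] C1_on_continuous_on[OF assms(3)] f(2) g(2)
        bounded_linear.continuous_on[OF bounded_linear_prod_right]
        bounded_linear.continuous_on[OF bounded_linear_prod_left]
      by (intro continuous_intros) auto
  qed
qed

lemma C1_on_scaleR:
  assumes "C1_on S a" "C1_on S v"
  shows "C1_on S (\<lambda>z. a z *\<^sub>R v z)"
  by (rule C1_on_bounded_bilinear[OF bounded_bilinear_scaleR assms])

lemma C1_on_add:
  assumes "C1_on S f" "C1_on S g"
  shows "C1_on S (\<lambda>z. f z + g z)"
  by (rule C1_on_compose[OF C1_on_bounded_linear[OF bounded_linear_add[OF bounded_linear_fst bounded_linear_snd]]
        C1_on_Pair[OF assms], of UNIV, simplified])

lemma C1_on_diff:
  assumes "C1_on S f" "C1_on S g"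
  shows "C1_on S (\<lambda>z. f z - g z)"
  by (rule C1_on_compose[OF C1_on_bounded_linear[OF bounded_linear_sub[OF bounded_linear_fst bounded_linear_snd]]
        C1_on_Pair[OF assms], of UNIV, simplified])

lemma C1_on_sum:
  assumes "\<And>j. j \<in> J \<Longrightarrow> C1_on S (f j)"
  shows "C1_on S (\<lambda>z. \<Sum>j\<in>J. f j z)"
  using assms
  by (induction J rule: infinite_finite_induct) (auto intro: C1_on_const C1_on_add)

lemma C2_on_imp_C1_on: "C2_on S f \<Longrightarrow> C1_on S f"
  unfolding C2_on_def using C1_onI C1_on_continuous_on by metis

lemma C2_on_subset:
  assumes "C2_on T f" "S \<subseteq> T"
  shows "C2_on S f"
  using assms C1_on_subset unfolding C2_on_def
  by (meson has_derivative_subset subsetD)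

text \<open>
  A total function giving the derivative as a bounded linear map, so that continuity of the
  derivative can be stated without choosing a witness for \<open>C1_on\<close>.
\<close>

definition fderiv :: "('a::real_normed_vector \<Rightarrow> 'b::real_normed_vector) \<Rightarrow> 'a \<Rightarrow> 'a \<Rightarrow>\<^sub>L 'b" where
  "fderiv f z = Blinfun (frechet_derivative f (at z))"

lemma fderiv_eq:
  assumes "(f has_derivative blinfun_apply D) (at z)"
  shows "fderiv f z = D"
  using frechet_derivative_at[OF assms] unfolding fderiv_def
  by (metis blinfun_apply_inverse)

lemma C1_on_fderiv:
  assumes "C1_on S f" "open S"
  shows C1_on_has_fderiv: "z \<in> S \<Longrightarrow> (f has_derivative blinfun_apply (fderiv f z)) (at z)"
    and C1_on_continuous_fderiv: "continuous_on S (fderiv f)"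
proof -
  obtain f' where f: "\<And>y. y \<in> S \<Longrightarrow> (f has_derivative blinfun_apply (f' y)) (at y within S)"
    "continuous_on S f'" using assms(1) unfolding C1_on_def by blast
  have at: "(f has_derivative blinfun_apply (f' y)) (at y)" if "y \<in> S" for y
    using f(1)[OF that] at_within_open[OF that assms(2)] by simp
  show "(f has_derivative blinfun_apply (fderiv f z)) (at z)" if "z \<in> S"
    using at[OF that] by (simp add: fderiv_eq[OF at[OF that]])
  show "continuous_on S (fderiv f)"
    using f(2) by (rule continuous_on_eq) (simp add: fderiv_eq[OF at])
qed

section \<open>Implicit differentiation\<close>

text \<open>
  Put \<open>u = z t - z a\<close> and \<open>v = t - a\<close>. Since \<open>F\<close> does not change along the curve, differentiability
  of \<open>F\<close> makes \<open>F' (u, v)\<close> small compared with \<open>norm u + norm v\<close>. Applying the left inverse \<open>T\<close> bounds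
  \<open>u + T (F' (0, v))\<close> in the same way; this first shows that \<open>norm u\<close> is at most a multiple of \<open>norm v\<close>
  and then that the remainder is small compared with \<open>norm v\<close> alone.
\<close>

lemma implicit_has_derivative:
  fixes z :: "'b::real_normed_vector \<Rightarrow> 'a::real_normed_vector"
  assumes z: "isCont z a"
    and F: "(F has_derivative F') (at (z a, a))"
    and zero: "\<forall>\<^sub>F t in at a. F (z t, t) = F (z a, a)"
    and T: "bounded_linear T" and TF': "\<And>u. T (F' (u, 0)) = u"
  shows "(z has_derivative (\<lambda>v. - T (F' (0, v)))) (at a)"
proof -
  interpret F': bounded_linear F' using F by (rule has_derivative_bounded_linear)
  interpret T: bounded_linear T by fact
  have lin: "bounded_linear (\<lambda>v. - T (F' (0, v)))"
    by (intro bounded_linear_minus bounded_linear_compose[OF T] bounded_linear_compose[OF F'.bounded_linear_axioms]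
        bounded_linear_Pair bounded_linear_zero bounded_linear_ident)
  obtain K where K: "K > 0" "\<And>v. norm (- T (F' (0, v))) \<le> norm v * K"
    using bounded_linear.pos_bounded[OF lin] by blast
  obtain k where k: "k > 0" "\<And>y. norm (T y) \<le> norm y * k"
    using T.pos_bounded by blast
  have lim: "((\<lambda>t. (z t, t)) \<longlongrightarrow> (z a, a)) (at a)"
    using z by (intro tendsto_intros) (simp add: isCont_def)
  show ?thesis
    unfolding has_derivative_within_alt2
  proof (intro conjI lin)
    have "\<forall>\<^sub>F t in at a. norm (z t - z a + T (F' (0, t - a))) \<le> e * norm (t - a)" if e: "e > 0" for e
    proof -
      \<comment> \<open>\<open>k * d \<le> 1/2\<close> absorbs \<open>norm u\<close>; the other bound makes the final remainder \<open>e * norm v\<close>.\<close>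
      define d where "d = min (1/2) (e / (2 * (K + 1))) / k"
      have kd: "k * d = min (1/2) (e / (2 * (K + 1)))"
        using k(1) by (simp add: d_def)
      have d: "d > 0"
        using e K(1) k(1) by (simp add: d_def)
      have kd_le: "k * d \<le> 1/2" "k * d \<le> e / (2 * (K + 1))"
        unfolding kd by (rule min.cobounded1, rule min.cobounded2)
      have kdK: "k * d * (2 * (K + 1)) \<le> e"
        using kd_le(2) K(1) by (simp add: pos_le_divide_eq)
      have "\<forall>\<^sub>F y in nhds (z a, a). norm (F y - F (z a, a) - F' (y - (z a, a))) \<le> d * norm (y - (z a, a))"
        using F d by (simp add: has_derivative_within_alt2 eventually_nhds_conv_at F'.zero)
      then have "\<forall>\<^sub>F t in at a. norm (F (z t, t) - F (z a, a) - F' ((z t, t) - (z a, a))) \<le> d * norm ((z t, t) - (z a, a))"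
        using lim by (rule eventually_compose_filterlim)
      with zero show ?thesis
      proof eventually_elim
        case (elim t)
        let ?u = "z t - z a" and ?v = "t - a"
        let ?r = "?u + T (F' (0, ?v))"
        have split: "F' (?u, ?v) = F' (?u, 0) + F' (0, ?v)"
          using F'.add[of "(?u, 0)" "(0, ?v)"] by simp
        have "?r = T (F' (?u, ?v))"
          by (simp add: split T.add TF')
        then have r: "norm ?r \<le> norm (F' (?u, ?v)) * k" by (simp add: k(2))
        have "norm (F' (?u, ?v)) \<le> d * norm (?u, ?v)"
          using elim by simp
        also have "\<dots> \<le> d * (norm ?u + norm ?v)"
          using d by (intro mult_left_mono norm_Pair_le) auto
        finally have "norm ?r \<le> d * (norm ?u + norm ?v) * k"
          using r k(1) by (meson less_imp_le mult_right_mono order_trans)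
        then have r': "norm ?r \<le> (k * d) * (norm ?u + norm ?v)" by (simp add: algebra_simps)
        have "norm ?u \<le> norm ?r + norm (T (F' (0, ?v)))"
          using norm_triangle_ineq4[of ?r "T (F' (0, ?v))"] by simp
        also have "\<dots> \<le> (k * d) * (norm ?u + norm ?v) + norm ?v * K"
          using r' K(2)[of ?v] by simp
        also have "\<dots> \<le> 1/2 * (norm ?u + norm ?v) + norm ?v * K"
          using kd_le(1) by (intro add_right_mono mult_right_mono) auto
        finally have "norm ?u \<le> (2 * K + 1) * norm ?v" by (simp add: algebra_simps)
        then have "norm ?u + norm ?v \<le> 2 * (K + 1) * norm ?v" by (simp add: algebra_simps)
        then have "norm ?r \<le> (k * d) * (2 * (K + 1) * norm ?v)"
          using r' d k(1) by (meson less_imp_le mult_left_mono mult_pos_pos order_trans)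
        also have "\<dots> \<le> e * norm ?v"
          using mult_right_mono[OF kdK, of "norm ?v"] by (simp add: mult.assoc)
        finally show ?case .
      qed
    qed
    then show "\<forall>e>0. \<forall>\<^sub>F t in at a. norm (z t - z a - - T (F' (0, t - a))) \<le> e * norm (t - a)"
      by simp
  qed
qed


text \<open>
  The derivative \<open>z' t\<close> solves \<open>P t \<circ> z' t = - Q t\<close>, where \<open>P\<close> and \<open>Q\<close> are the partial derivatives of \<open>F\<close>
  along the branch. The left inverses \<open>T t\<close> are chosen pointwise, without control
  over how they vary with \<open>t\<close>; continuity of \<open>z'\<close> at \<open>a\<close> is therefore obtained from this equation
  with the single left inverse \<open>T a\<close>.
\<close>

lemma implicit_C1:
  fixes z :: "'b::real_normed_vector \<Rightarrow> 'a::euclidean_space"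
    and F :: "'a \<times> 'b \<Rightarrow> 'c::euclidean_space"
  assumes N: "open N" and F: "C1_on (UNIV \<times> N) F" and z: "continuous_on N z"
    and zero: "\<And>t. t \<in> N \<Longrightarrow> F (z t, t) = 0"
    and inj: "\<And>t u. t \<in> N \<Longrightarrow> fderiv F (z t, t) (u, 0) = 0 \<Longrightarrow> u = 0"
  shows "C1_on N z"
proof -
  define P where "P t = fderiv F (z t, t) o\<^sub>L Blinfun (\<lambda>u. (u, 0))" for t
  define Q where "Q t = fderiv F (z t, t) o\<^sub>L Blinfun (\<lambda>v. (0, v))" for t
  have bl: "bounded_linear (\<lambda>x::'a. (x, 0::'b))" "bounded_linear (\<lambda>x::'b. (0::'a, x))"
    by (auto intro!: bounded_linear_Pair bounded_linear_ident bounded_linear_zero)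
  have P_app: "P t u = fderiv F (z t, t) (u, 0)" and Q_app: "Q t v = fderiv F (z t, t) (0, v)" for t u v
    by (simp_all add: P_def Q_def bounded_linear_Blinfun_apply bl)
  have open': "open (UNIV \<times> N :: ('a \<times> 'b) set)"
    using N by (simp add: open_Times)
  have cont: "continuous_on N (\<lambda>t. fderiv F (z t, t))"
    by (rule continuous_on_compose2[OF C1_on_continuous_fderiv[OF F open']])
       (auto intro!: continuous_intros z)
  have P: "continuous_on N P" and Q: "continuous_on N Q"
    unfolding P_def Q_def by (intro continuous_intros cont)+
  have "\<exists>T :: 'c \<Rightarrow>\<^sub>L 'a. \<forall>u. T (P t u) = u" if t: "t \<in> N" for t
  proof -
    have lin: "linear (P t)"
      by (intro bounded_linear.linear blinfun.bounded_linear_right)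
    have "inj (P t)"
      unfolding linear_injective_0[OF lin] using inj[OF t] by (simp add: P_app)
    then obtain g where g: "linear g" "g \<circ> P t = id"
      using linear_injective_left_inverse[OF lin] by blast
    from g(1) have "bounded_linear g"
      by (simp add: linear_conv_bounded_linear)
    with g(2) show ?thesis
      by (intro exI[of _ "Blinfun g"]) (simp add: bounded_linear_Blinfun_apply pointfree_idE)
  qed
  then have "\<forall>t\<in>N. \<exists>T :: 'c \<Rightarrow>\<^sub>L 'a. \<forall>u. T (P t u) = u"
    by blast
  from bchoice[OF this] obtain T :: "'b \<Rightarrow> 'c \<Rightarrow>\<^sub>L 'a"
    where T': "\<forall>t\<in>N. \<forall>u. T t (P t u) = u" ..
  then have T: "T t (P t u) = u" if "t \<in> N" for t u
    using that by blast
  define z' where "z' t = - (T t o\<^sub>L Q t)" for t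
  have z': "(z has_derivative z' t) (at t)" if t: "t \<in> N" for t
  proof -
    have "(z has_derivative (\<lambda>v. - T t (fderiv F (z t, t) (0, v)))) (at t)"
    proof (rule implicit_has_derivative[where F = F and F' = "fderiv F (z t, t)" and T = "T t"])
      show "isCont z t" using z t by (simp add: continuous_on_eq_continuous_at[OF N])
      show "(F has_derivative fderiv F (z t, t)) (at (z t, t))"
        by (rule C1_on_has_fderiv[OF F open']) (use t in auto)
      have "\<forall>\<^sub>F s in at t. s \<in> N" using N t by (rule eventually_at_in_open')
      then show "\<forall>\<^sub>F s in at t. F (z s, s) = F (z t, t)"
        by eventually_elim (simp add: zero t)
    next
      show "T t (fderiv F (z t, t) (u, 0)) = u" for u
        using T[OF t, of u] by (simp only: P_app)
    qed (rule blinfun.bounded_linear_right)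
    moreover have "blinfun_apply (z' t) = (\<lambda>v. - T t (fderiv F (z t, t) (0, v)))"
      by (auto simp: z'_def Q_app blinfun.bilinear_simps)
    ultimately show ?thesis by simp
  qed
  have Pz': "P t (z' t v) = - Q t v" if t: "t \<in> N" for t v
  proof -
    have "((\<lambda>s. (z s, s)) has_derivative (\<lambda>v. (z' t v, v))) (at t)"
      by (intro has_derivative_Pair z'[OF t] has_derivative_ident)
    moreover have "(F has_derivative fderiv F (z t, t)) (at (z t, t))"
      by (rule C1_on_has_fderiv[OF F open']) (use t in auto)
    ultimately have "((\<lambda>s. F (z s, s)) has_derivative (\<lambda>v. fderiv F (z t, t) (z' t v, v))) (at t)"
      by (rule has_derivative_compose)
    moreover have "((\<lambda>s. F (z s, s)) has_derivative (\<lambda>v. 0)) (at t)"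
      by (rule has_derivative_transform_within_open[OF has_derivative_const N t, of 0]) (simp add: zero)
    ultimately have "(\<lambda>v. fderiv F (z t, t) (z' t v, v)) = (\<lambda>v. 0)"
      by (rule has_derivative_unique)
    then have "fderiv F (z t, t) (z' t v, v) = 0"
      by (rule fun_cong)
    then have "fderiv F (z t, t) ((z' t v, 0) + (0, v)) = 0" by simp
    then show ?thesis
      unfolding blinfun.add_right by (simp add: P_app Q_app add_eq_0_iff2)
  qed
  have "continuous (at a within N) z'" if a: "a \<in> N" for a
  proof -
    let ?E = "\<lambda>t. P t - P a" and ?R = "\<lambda>t. Q t - Q a"
    \<comment> \<open>The factor 2 comes from absorbing half of \<open>norm (z' t - z' a)\<close> into the left-hand side.\<close>
    let ?b = "\<lambda>t. 2 * norm (T a) * (norm (?R t) + norm (?E t) * norm (z' a))"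
    have P0: "(P \<longlongrightarrow> P a) (at a within N)" and Q0: "(Q \<longlongrightarrow> Q a) (at a within N)"
      using P Q a by (auto simp: continuous_on_def)
    have b0: "(?b \<longlongrightarrow> 2 * norm (T a) * (norm (Q a - Q a) + norm (P a - P a) * norm (z' a))) (at a within N)"
      by (intro tendsto_intros P0 Q0)
    have "((\<lambda>t. norm (T a) * norm (?E t)) \<longlongrightarrow> norm (T a) * norm (P a - P a)) (at a within N)"
      by (intro tendsto_intros P0)
    then have "\<forall>\<^sub>F t in at a within N. norm (T a) * norm (?E t) < 1/2"
      by (rule order_tendstoD) simp
    moreover have "\<forall>\<^sub>F t in at a within N. t \<in> N"
      by (simp add: eventually_at_filter)
    ultimately have "\<forall>\<^sub>F t in at a within N. norm (z' t - z' a) \<le> ?b t"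
    proof eventually_elim
      case (elim t)
      let ?w = "z' t - z' a"
      have "?w = T a o\<^sub>L (- ?R t - (?E t o\<^sub>L ?w) - (?E t o\<^sub>L z' a))"
      proof (rule blinfun_eqI)
        fix v
        have X: "(- ?R t - (?E t o\<^sub>L ?w) - (?E t o\<^sub>L z' a)) v = P a (?w v)"
          by (simp add: blinfun.bilinear_simps Pz' a elim(2))
        show "?w v = (T a o\<^sub>L (- ?R t - (?E t o\<^sub>L ?w) - (?E t o\<^sub>L z' a))) v"
          by (simp only: blinfun_apply_blinfun_compose X T[OF a])
      qed
      then have "norm ?w = norm (T a o\<^sub>L (- ?R t - (?E t o\<^sub>L ?w) - (?E t o\<^sub>L z' a)))"
        by (rule arg_cong)
      also have "\<dots> \<le> norm (T a) * norm (- ?R t - (?E t o\<^sub>L ?w) - (?E t o\<^sub>L z' a))"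
        by (rule norm_blinfun_compose)
      also have "\<dots> \<le> norm (T a) * (norm (?R t) + norm (?E t) * norm ?w + norm (?E t) * norm (z' a))"
      proof (intro mult_left_mono norm_ge_zero)
        have "norm (- ?R t - (?E t o\<^sub>L ?w) - (?E t o\<^sub>L z' a))
            \<le> norm (- ?R t) + norm (?E t o\<^sub>L ?w) + norm (?E t o\<^sub>L z' a)"
          by (meson add_right_mono norm_triangle_ineq4 order_trans)
        then show "norm (- ?R t - (?E t o\<^sub>L ?w) - (?E t o\<^sub>L z' a))
            \<le> norm (?R t) + norm (?E t) * norm ?w + norm (?E t) * norm (z' a)"
          using norm_blinfun_compose[of "?E t" ?w] norm_blinfun_compose[of "?E t" "z' a"]
          unfolding norm_minus_cancel by linarith
      qed
      also have "\<dots> = norm (T a) * norm (?E t) * norm ?w + ?b t / 2"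
        by (simp add: algebra_simps)
      also have "\<dots> \<le> 1/2 * norm ?w + ?b t / 2"
        using elim(1) by (intro add_right_mono mult_right_mono) auto
      finally show ?case by simp
    qed
    then have "((\<lambda>t. z' t - z' a) \<longlongrightarrow> 0) (at a within N)"
      by (rule Lim_null_comparison) (use b0 in simp)
    then show ?thesis
      by (simp add: continuous_within LIM_zero_iff)
  qed
  then have cont_z': "continuous_on N z'"
    by (simp add: continuous_on_eq_continuous_within)
  show ?thesis
  proof (rule C1_onI)
    show "(z has_derivative z' t) (at t within N)" if "t \<in> N" for t
      using z'[OF that] by (rule has_derivative_at_withinI)
  qed (rule cont_z')
qed

section \<open>Invertible matrices and the Schur complement\<close>

lemma invertible_mat_if_trivial_kernel:
  fixes A :: "real mat"
  assumes A: "A \<in> carrier_mat n n"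
    and ker: "\<And>w. w \<in> carrier_vec n \<Longrightarrow> A *\<^sub>v w = 0\<^sub>v n \<Longrightarrow> w = 0\<^sub>v n"
  shows "invertible_mat A"
proof -
  have "Determinant.det A \<noteq> 0"
    using ker by (auto simp: det_0_iff_vec_prod_zero_field[OF A])
  then have "A \<in> Units (ring_mat TYPE(real) n ())"
    by (rule det_non_zero_imp_unit[OF A])
  then obtain B where "B \<in> carrier_mat n n" "B * A = 1\<^sub>m n" "A * B = 1\<^sub>m n"
    unfolding Units_def ring_mat_def by auto
  with A show ?thesis
    unfolding invertible_mat_def inverts_mat_def by (intro conjI exI[of _ B]) auto
qed

lemma minv:
  assumes A: "A \<in> carrier_mat n n" and inv: "invertible_mat A"
  shows minv_carrier: "minv A \<in> carrier_mat n n"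
    and "A * minv A = 1\<^sub>m n"
    and "minv A * A = 1\<^sub>m n"
proof -
  from inv obtain B where B: "A * B = 1\<^sub>m n" "B * A = 1\<^sub>m (dim_row B)"
    using A unfolding invertible_mat_def inverts_mat_def by auto
  then have "dim_col B = n" "dim_row B = n"
    using A by (metis carrier_matD(2) index_mult_mat(3) index_one_mat(3))+
  with B have "B \<in> carrier_mat n n" "B * A = 1\<^sub>m n" "A * B = 1\<^sub>m n"
    by auto
  then have "A \<in> Units (ring_mat TYPE(real) n ())"
    using A unfolding Units_def ring_mat_def by auto
  then obtain C where C: "mat_inverse A = Some C"
    using mat_inverse(1)[OF A, of "()"] by (cases "mat_inverse A") auto
  show "minv A \<in> carrier_mat n n" "A * minv A = 1\<^sub>m n" "minv A * A = 1\<^sub>m n"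
    using mat_inverse(2)[OF A C] by (auto simp: minv_def C)
qed

lemma scalar_prod_self_eq_0:
  fixes w :: "real Matrix.vec"
  assumes w: "w \<in> carrier_vec n" and 0: "scalar_prod w w = 0"
  shows "w = 0\<^sub>v n"
proof (rule eq_vecI)
  fix i assume i: "i < dim_vec (0\<^sub>v n :: real Matrix.vec)"
  have "vec_index w j * vec_index w j = 0" if "j < n" for j
    using 0 w that by (auto simp: scalar_prod_def sum_nonneg_eq_0_iff)
  then show "vec_index w i = vec_index (0\<^sub>v n) i"
    using i by simp
qed (use w in auto)

text \<open>
  \<open>w \<bullet> B B\<^sup>T w\<close> is the squared length of \<open>B\<^sup>T w\<close>.
\<close>

lemma gram_matrix_invertible:
  fixes B :: "real mat"
  assumes B: "B \<in> carrier_mat k n"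
    and rows: "\<And>w. w \<in> carrier_vec k \<Longrightarrow> B\<^sup>T *\<^sub>v w = 0\<^sub>v n \<Longrightarrow> w = 0\<^sub>v k"
  shows "invertible_mat (B * B\<^sup>T)"
proof (rule invertible_mat_if_trivial_kernel)
  fix w :: "real Matrix.vec" assume w: "w \<in> carrier_vec k" "(B * B\<^sup>T) *\<^sub>v w = 0\<^sub>v k"
  have Bw: "B\<^sup>T *\<^sub>v w \<in> carrier_vec n" using B w by auto
  have "scalar_prod (B\<^sup>T *\<^sub>v w) (B\<^sup>T *\<^sub>v w) = scalar_prod w (B *\<^sub>v (B\<^sup>T *\<^sub>v w))"
    by (rule transpose_vec_mult_scalar[OF B Bw w(1)])
  also have "B *\<^sub>v (B\<^sup>T *\<^sub>v w) = 0\<^sub>v k"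
    using w B by simp
  finally have "scalar_prod (B\<^sup>T *\<^sub>v w) (B\<^sup>T *\<^sub>v w) = 0"
    using w by simp
  with Bw have "B\<^sup>T *\<^sub>v w = 0\<^sub>v n" by (rule scalar_prod_self_eq_0)
  with w(1) show "w = 0\<^sub>v k" by (rule rows)
qed (use B in auto)

text \<open>
  If \<open>B A\<^sup>-\<^sup>1 B\<^sup>T w = 0\<close>, then \<open>u = A\<^sup>-\<^sup>1 B\<^sup>T w\<close> satisfies \<open>B u = 0\<close> and hence
  \<open>u \<bullet> A u = u \<bullet> B\<^sup>T w = B u \<bullet> w = 0\<close>.
\<close>

lemma schur_complement_invertible:
  fixes A B :: "real mat"
  assumes A: "A \<in> carrier_mat n n" and B: "B \<in> carrier_mat k n" and inv: "invertible_mat A"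
    and pos: "\<And>u. u \<in> carrier_vec n \<Longrightarrow> u \<noteq> 0\<^sub>v n \<Longrightarrow> scalar_prod u (A *\<^sub>v u) > 0"
    and rows: "\<And>w. w \<in> carrier_vec k \<Longrightarrow> B\<^sup>T *\<^sub>v w = 0\<^sub>v n \<Longrightarrow> w = 0\<^sub>v k"
  shows "invertible_mat (B * minv A * B\<^sup>T)"
proof (rule invertible_mat_if_trivial_kernel)
  note Ai = minv[OF A inv]
  fix w :: "real Matrix.vec" assume w: "w \<in> carrier_vec k" "(B * minv A * B\<^sup>T) *\<^sub>v w = 0\<^sub>v k"
  define u where "u = minv A *\<^sub>v (B\<^sup>T *\<^sub>v w)"
  have Bw: "B\<^sup>T *\<^sub>v w \<in> carrier_vec n" using B w by auto
  have u: "u \<in> carrier_vec n" unfolding u_def using Ai(1) Bw by auto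
  have "A *\<^sub>v u = (A * minv A) *\<^sub>v (B\<^sup>T *\<^sub>v w)"
    unfolding u_def by (rule assoc_mult_mat_vec[symmetric, OF A Ai(1) Bw])
  then have Au: "A *\<^sub>v u = B\<^sup>T *\<^sub>v w"
    using Bw by (simp add: Ai(2))
  have Bu: "B *\<^sub>v u = 0\<^sub>v k"
  proof -
    have "(B * minv A * B\<^sup>T) *\<^sub>v w = (B * minv A) *\<^sub>v (B\<^sup>T *\<^sub>v w)"
      by (rule assoc_mult_mat_vec[of _ k n _ k]) (use B Ai(1) w in auto)
    also have "\<dots> = B *\<^sub>v u"
      unfolding u_def by (rule assoc_mult_mat_vec[OF B Ai(1) Bw])
    finally show ?thesis using w(2) by simp
  qed
  have "scalar_prod u (A *\<^sub>v u) = scalar_prod (B\<^sup>T *\<^sub>v w) u"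
    unfolding Au by (rule comm_scalar_prod[OF u Bw])
  also have "\<dots> = scalar_prod w (B *\<^sub>v u)"
    by (rule transpose_vec_mult_scalar[OF B u w(1)])
  also have "\<dots> = 0" using w(1) by (simp add: Bu)
  finally have "u = 0\<^sub>v n" using pos[OF u] by force
  moreover have "A *\<^sub>v 0\<^sub>v n = 0\<^sub>v n" using A by (intro eq_vecI) auto
  ultimately have "B\<^sup>T *\<^sub>v w = 0\<^sub>v n" by (simp flip: Au)
  with w(1) show "w = 0\<^sub>v k" by (rule rows)
qed (use A B minv_carrier[OF A inv] in auto)

lemma mult_mat_cancel:
  fixes P Q M :: "real mat"
  assumes "P \<in> carrier_mat n k" "Q \<in> carrier_mat k n" "M \<in> carrier_mat n r" "P * Q = 1\<^sub>m n"
  shows "P * (Q * M) = M"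
  using assoc_mult_mat[OF assms(1-3)] assms(3,4) by simp

lemma mat_add_eq_uminus_iff:
  fixes X Y Z :: "real mat"
  assumes "X \<in> carrier_mat n r" "Y \<in> carrier_mat n r" "Z \<in> carrier_mat n r"
  shows "X + Z = - Y \<longleftrightarrow> X = - Y - Z" and "X + Z = - Y \<longleftrightarrow> Z = - Y - X"
  using assms by (auto simp: mat_eq_iff) (smt (verit))+

text \<open>
  Block elimination: multiplying the first equation by \<open>B A\<^sup>-\<^sup>1\<close> and inserting the second gives
  \<open>V = W\<^sup>-\<^sup>1 (G - B A\<^sup>-\<^sup>1 L)\<close> with \<open>W = B A\<^sup>-\<^sup>1 B\<^sup>T\<close>, and \<open>X = - A\<^sup>-\<^sup>1 (L + B\<^sup>T V)\<close>. The pseudoinverse enters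
  only through \<open>B B\<^sup>\<dagger> = 1\<close> and its transpose: \<open>\<Sigma> B\<^sup>\<dagger> G = A\<^sup>-\<^sup>1 B\<^sup>T W\<^sup>-\<^sup>1 G\<close> and
  \<open>(B\<^sup>\<dagger>)\<^sup>T A \<Sigma> = W\<^sup>-\<^sup>1 B\<close>.
\<close>

lemma kkt_system_solution:
  fixes A B L G X V :: "real mat"
  assumes A: "A \<in> carrier_mat n n" and B: "B \<in> carrier_mat k n"
    and L: "L \<in> carrier_mat n r" and G: "G \<in> carrier_mat k r"
    and X: "X \<in> carrier_mat n r" and V: "V \<in> carrier_mat k r"
    and iA: "invertible_mat A" and iH: "invertible_mat (B * B\<^sup>T)"
    and iW: "invertible_mat (B * minv A * B\<^sup>T)"
    and stat: "A * X + B\<^sup>T * V = - L" and constr: "B * X = - G"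
  shows "X = - (Pi_mat A B * minv A * L) - Sigma_mat A B * pinv B * G"
    and "V = - ((pinv B)\<^sup>T * A * Sigma_mat A B * (minv A * L - pinv B * G))"
proof -
  let ?Ai = "minv A" and ?W = "B * minv A * B\<^sup>T" and ?E = "pinv B" and ?S = "Sigma_mat A B"
  let ?Wi = "minv ?W"
  have Bt: "B\<^sup>T \<in> carrier_mat n k" using B by simp
  note Ai = minv[OF A iA]
  have Wc: "?W \<in> carrier_mat k k" using B Ai(1) by auto
  note Wi = minv[OF Wc iW]
  have H: "B * B\<^sup>T \<in> carrier_mat k k" using B by auto
  note Hi = minv[OF H iH]
  have E: "?E \<in> carrier_mat n k" unfolding pinv_def using Bt Hi(1) by auto
  have BE: "B * ?E = 1\<^sub>m k"
    unfolding pinv_def using assoc_mult_mat[OF B Bt Hi(1)] Hi(2) by simp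
  have EB: "?E\<^sup>T * B\<^sup>T = 1\<^sub>m k"
    using transpose_mult[OF B E] BE by simp
  have WiB: "?Wi * B \<in> carrier_mat k n" using Wi(1) B by auto
  have S: "?S = ?Ai * (B\<^sup>T * (?Wi * B))"
    unfolding Sigma_mat_def
    using assoc_mult_mat[OF mult_carrier_mat[OF Ai(1) Bt] Wi(1) B] assoc_mult_mat[OF Ai(1) Bt WiB] by simp
  have Sc: "?S \<in> carrier_mat n n" unfolding S by (intro mult_carrier_mat[OF Ai(1)] mult_carrier_mat[OF Bt WiB])
  define Y where "Y = ?Ai * L"
  have Y: "Y \<in> carrier_mat n r" unfolding Y_def using Ai(1) L by auto
  have BY: "B * Y \<in> carrier_mat k r" using B Y by auto
  have BtV: "B\<^sup>T * V \<in> carrier_mat n r" using Bt V by auto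
  have "?Ai * (A * X + B\<^sup>T * V) = X + ?Ai * (B\<^sup>T * V)"
    using mult_add_distrib_mat[OF Ai(1) mult_carrier_mat[OF A X] BtV]
      mult_mat_cancel[OF Ai(1) A X Ai(3)] by simp
  then have eqX: "X + ?Ai * (B\<^sup>T * V) = - Y"
    unfolding stat Y_def using Ai(1) L by simp
  have AiBtV: "?Ai * (B\<^sup>T * V) \<in> carrier_mat n r" using Ai(1) BtV by auto
  have X_eq: "X = - Y - ?Ai * (B\<^sup>T * V)"
    using eqX mat_add_eq_uminus_iff(1)[OF X Y AiBtV] by simp
  have "?W * V = B * (?Ai * (B\<^sup>T * V))"
    using assoc_mult_mat[OF mult_carrier_mat[OF B Ai(1)] Bt V] assoc_mult_mat[OF B Ai(1) BtV] by simp
  also have "?Ai * (B\<^sup>T * V) = - Y - X"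
    using eqX mat_add_eq_uminus_iff(2)[OF X Y AiBtV] by simp
  also have "B * (- Y - X) = - (B * Y) - B * X"
    using mult_minus_distrib_mat[OF B uminus_carrier_mat[OF Y] X] B Y by simp
  also have "\<dots> = G - B * Y"
    unfolding constr by (rule eq_matI) (use G BY in \<open>auto simp del: index_mult_mat\<close>)
  finally have WV: "?W * V = G - B * Y" .
  have "V = ?Wi * (?W * V)"
    by (rule mult_mat_cancel[OF Wi(1) Wc V Wi(3), symmetric])
  then have V_eq: "V = ?Wi * G - ?Wi * (B * Y)"
    unfolding WV using mult_minus_distrib_mat[OF Wi(1) G BY] by simp
  have WiG: "?Wi * G \<in> carrier_mat k r" and WiBY: "?Wi * (B * Y) \<in> carrier_mat k r"
    using Wi(1) G BY by auto
  have SM: "?S * M = ?Ai * (B\<^sup>T * (?Wi * (B * M)))" if M: "M \<in> carrier_mat n r" for M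
  proof -
    have BM: "B * M \<in> carrier_mat k r" using B M by auto
    show ?thesis
      unfolding S using assoc_mult_mat[OF Ai(1) mult_carrier_mat[OF Bt WiB] M]
        assoc_mult_mat[OF Bt WiB M] assoc_mult_mat[OF Wi(1) B M] by simp
  qed
  have EG: "?E * G \<in> carrier_mat n r" using E G by auto
  have BEG: "B * (?E * G) = G"
    by (rule mult_mat_cancel[OF B E G BE])
  have SEG: "?S * ?E * G = ?Ai * (B\<^sup>T * (?Wi * G))"
    using assoc_mult_mat[OF Sc E G] SM[OF EG] BEG by simp
  have "Pi_mat A B * ?Ai * L = Pi_mat A B * Y"
    unfolding Y_def Pi_mat_def
    by (rule assoc_mult_mat[OF _ Ai(1) L]) (use A Sc in auto)
  also have "\<dots> = Y - ?S * Y"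
    unfolding Pi_mat_def using A minus_mult_distrib_mat[OF one_carrier_mat Sc Y] Y by simp
  finally have PAL: "Pi_mat A B * ?Ai * L = Y - ?S * Y" .
  have "?Ai * (B\<^sup>T * V) = ?Ai * (B\<^sup>T * (?Wi * G)) - ?Ai * (B\<^sup>T * (?Wi * (B * Y)))"
    by (subst V_eq, subst mult_minus_distrib_mat[OF Bt WiG WiBY],
        rule mult_minus_distrib_mat[OF Ai(1) mult_carrier_mat[OF Bt WiG] mult_carrier_mat[OF Bt WiBY]])
  also have "\<dots> = ?S * ?E * G - ?S * Y"
    by (simp only: SEG SM[OF Y])
  finally have AiBtV_eq: "?Ai * (B\<^sup>T * V) = ?S * ?E * G - ?S * Y" .
  have SY: "?S * Y \<in> carrier_mat n r" and SEGc: "?S * ?E * G \<in> carrier_mat n r"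
    using Sc Y E G by auto
  show "X = - (Pi_mat A B * minv A * L) - Sigma_mat A B * pinv B * G"
    unfolding PAL by (subst X_eq, subst AiBtV_eq, rule eq_matI)
      (use Y SY SEGc in \<open>auto simp del: index_mult_mat\<close>)
  have Et: "?E\<^sup>T \<in> carrier_mat k n" using E by simp
  have YEG: "Y - ?E * G \<in> carrier_mat n r" by (rule minus_carrier_mat[OF EG])
  have BYEG: "B * (Y - ?E * G) = B * Y - G"
    using mult_minus_distrib_mat[OF B Y EG] BEG by simp
  have "?E\<^sup>T * A * ?S * (Y - ?E * G) = ?E\<^sup>T * (A * (?S * (Y - ?E * G)))"
    using assoc_mult_mat[OF mult_carrier_mat[OF Et A] Sc YEG]
      assoc_mult_mat[OF Et A mult_carrier_mat[OF Sc YEG]] by simp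
  also have "A * (?S * (Y - ?E * G)) = B\<^sup>T * (?Wi * (B * Y - G))"
  proof -
    have c: "B\<^sup>T * (?Wi * (B * Y - G)) \<in> carrier_mat n r"
      by (intro mult_carrier_mat[OF Bt] mult_carrier_mat[OF Wi(1)]) (use BY G in auto)
    show ?thesis
      unfolding SM[OF YEG] BYEG by (rule mult_mat_cancel[OF A Ai(1) c Ai(2)])
  qed
  also have "?E\<^sup>T * (B\<^sup>T * (?Wi * (B * Y - G))) = ?Wi * (B * Y - G)"
  proof -
    have c: "?Wi * (B * Y - G) \<in> carrier_mat k r"
      by (intro mult_carrier_mat[OF Wi(1)]) (use BY G in auto)
    show ?thesis
      by (rule mult_mat_cancel[OF Et Bt c EB])
  qed
  also have "\<dots> = ?Wi * (B * Y) - ?Wi * G"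
    by (rule mult_minus_distrib_mat[OF Wi(1) BY G])
  finally have eq: "?E\<^sup>T * A * ?S * (Y - ?E * G) = ?Wi * (B * Y) - ?Wi * G" .
  show "V = - ((pinv B)\<^sup>T * A * Sigma_mat A B * (minv A * L - pinv B * G))"
    unfolding Y_def[symmetric] eq
    by (subst V_eq, rule eq_matI) (use WiG WiBY in \<open>auto simp del: index_mult_mat\<close>)
qed

text \<open>
  The entries of a product that passes through dimension 0 are empty sums.
\<close>

lemma no_constraints_mats:
  fixes A B G :: "real mat"
  assumes A: "A \<in> carrier_mat n n" and B: "B \<in> carrier_mat 0 n" and G: "G \<in> carrier_mat 0 r"
    and iA: "invertible_mat A" and iH: "invertible_mat (B * B\<^sup>T)"
    and iW: "invertible_mat (B * minv A * B\<^sup>T)"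
  shows "pinv B * G = 0\<^sub>m n r" "Sigma_mat A B = 0\<^sub>m n n" "Pi_mat A B = 1\<^sub>m n"
proof -
  have zero: "M * K = 0\<^sub>m n c" if "M \<in> carrier_mat n 0" "K \<in> carrier_mat 0 c" for M K :: "real mat" and c
    using that by (intro eq_matI) (auto simp: scalar_prod_def)
  have Bt: "B\<^sup>T \<in> carrier_mat n 0" using B by simp
  have "pinv B \<in> carrier_mat n 0"
    unfolding pinv_def using minv_carrier[OF _ iH, of 0] B by auto
  then show "pinv B * G = 0\<^sub>m n r" using G by (rule zero)
  have "minv A * B\<^sup>T * minv (B * minv A * B\<^sup>T) \<in> carrier_mat n 0"
    using minv_carrier[OF A iA] minv_carrier[OF _ iW, of 0] B by auto
  then show S: "Sigma_mat A B = 0\<^sub>m n n"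
    unfolding Sigma_mat_def using B by (rule zero)
  show "Pi_mat A B = 1\<^sub>m n"
    unfolding Pi_mat_def S using A by (intro eq_matI) auto
qed

section \<open>Coordinates\<close>

definition coord_vec :: "real^'a::finite \<Rightarrow> real Matrix.vec" where
  "coord_vec y = Matrix.vec CARD('a) (\<lambda>i. y $ coord i)"

lemma to_mat_carrier: "to_mat (M :: real^'c::finite^'a::finite) \<in> carrier_mat CARD('a) CARD('c)"
  by (simp add: to_mat_def)

lemma mat_of_row_list_carrier:
  "mat_of_row_list (vs :: (real^'c::finite) list) \<in> carrier_mat (length vs) CARD('c)"
  by (simp add: mat_of_row_list_def)

lemma sum_coord: "(\<Sum>i = 0..<CARD('a). F (coord i)) = (\<Sum>a\<in>UNIV. F (a :: 'a::finite))"
  using sum.reindex_bij_betw[OF bij_betw_coord, of F] by (simp add: atLeast0LessThan)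

lemma ex_coord: "\<exists>i<CARD('a). a = (coord i :: 'a::finite)"
  using bij_betw_coord[where 'a = 'a] by (auto simp: bij_betw_def image_iff set_eq_iff)

lemma sum_nth_distinct:
  assumes "distinct js"
  shows "(\<Sum>i<length js. F (js ! i)) = (\<Sum>j\<in>set js. F j)"
  using sum.reindex_bij_betw[OF bij_betw_nth[OF assms refl refl], of F] .

lemma coord_vec_surj:
  assumes "w \<in> carrier_vec CARD('a)"
  shows "\<exists>y :: real^'a::finite. w = coord_vec y"
proof
  let ?i = "the_inv_into {..<CARD('a)} (coord :: nat \<Rightarrow> 'a)"
  have "?i (coord j) = j" if "j < CARD('a)" for j
    using bij_betw_coord[where 'a = 'a] that by (intro the_inv_into_f_f) (auto simp: bij_betw_def)
  then show "w = coord_vec (\<chi> a. vec_index w (?i a))"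
    using assms by (intro eq_vecI) (auto simp: coord_vec_def)
qed

lemma coord_vec_eq_0_iff: "coord_vec (y :: real^'a::finite) = 0\<^sub>v CARD('a) \<longleftrightarrow> y = 0"
proof
  assume *: "coord_vec y = 0\<^sub>v CARD('a)"
  have "y $ coord i = 0" if "i < CARD('a)" for i
    using arg_cong[OF *, of "\<lambda>w. vec_index w i"] that by (simp add: coord_vec_def)
  then show "y = 0"
    unfolding Finite_Cartesian_Product.vec_eq_iff using ex_coord by (metis zero_index)
qed (auto simp: coord_vec_def intro!: eq_vecI)

lemma scalar_prod_coord_vec: "scalar_prod (coord_vec x) (coord_vec (y :: real^'a::finite)) = x \<bullet> y"
  using sum_coord[of "\<lambda>a. x $ a * y $ a"]
  by (simp add: scalar_prod_def coord_vec_def inner_vec_def)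

lemma to_mat_mult_coord_vec:
  fixes M :: "real^'c::finite^'a::finite"
  shows "to_mat M *\<^sub>v coord_vec y = coord_vec (M *v y)"
proof (rule eq_vecI)
  fix i assume i: "i < dim_vec (coord_vec (M *v y))"
  then have "vec_index (to_mat M *\<^sub>v coord_vec y) i = (\<Sum>j = 0..<CARD('c). M $ coord i $ coord j * y $ coord j)"
    by (simp add: to_mat_def coord_vec_def scalar_prod_def)
  also have "\<dots> = (M *v y) $ coord i"
    using sum_coord[of "\<lambda>a. M $ coord i $ a * y $ a"] by (simp add: matrix_vector_mult_def)
  finally show "vec_index (to_mat M *\<^sub>v coord_vec y) i = vec_index (coord_vec (M *v y)) i"
    using i by (simp add: coord_vec_def)
qed (simp add: to_mat_def coord_vec_def)

lemma transpose_mat_of_row_list_mult: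
  fixes vs :: "(real^'c::finite) list"
  assumes w: "w \<in> carrier_vec (length vs)"
  shows "(mat_of_row_list vs)\<^sup>T *\<^sub>v w = coord_vec (\<Sum>j<length vs. vec_index w j *\<^sub>R vs ! j)"
  using w by (intro eq_vecI)
    (auto simp: mat_of_row_list_def coord_vec_def scalar_prod_def atLeast0LessThan mult.commute)

lemma to_mat_pos_def:
  fixes M :: "real^'a::finite^'a"
  assumes "pos_def M" "u \<in> carrier_vec CARD('a)" "u \<noteq> 0\<^sub>v CARD('a)"
  shows "scalar_prod u (to_mat M *\<^sub>v u) > 0"
proof -
  obtain y :: "real^'a" where u: "u = coord_vec y" using coord_vec_surj[OF assms(2)] by blast
  with assms(3) have "y \<noteq> 0" by (metis coord_vec_eq_0_iff)
  with assms(1) show ?thesis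
    by (simp add: u to_mat_mult_coord_vec scalar_prod_coord_vec pos_def_def)
qed

lemma pos_def_invertible:
  fixes M :: "real^'a::finite^'a"
  assumes "pos_def M"
  shows "invertible_mat (to_mat M)"
proof (rule invertible_mat_if_trivial_kernel[OF to_mat_carrier], rule ccontr)
  fix w assume w: "w \<in> carrier_vec CARD('a)" "to_mat M *\<^sub>v w = 0\<^sub>v CARD('a)" "w \<noteq> 0\<^sub>v CARD('a)"
  then show False using to_mat_pos_def[OF assms w(1,3)] by simp
qed

lemma mat_of_row_list_transpose_kernel:
  fixes vs :: "(real^'c::finite) list"
  assumes indep: "\<And>a. (\<Sum>j<length vs. a j *\<^sub>R vs ! j) = 0 \<Longrightarrow> \<forall>j<length vs. a j = 0"
    and w: "w \<in> carrier_vec (length vs)" "(mat_of_row_list vs)\<^sup>T *\<^sub>v w = 0\<^sub>v CARD('c)"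
  shows "w = 0\<^sub>v (length vs)"
proof -
  have "\<forall>j<length vs. vec_index w j = 0"
    using w(2) unfolding transpose_mat_of_row_list_mult[OF w(1)] coord_vec_eq_0_iff by (rule indep)
  then show ?thesis using w(1) by (intro eq_vecI) auto
qed

text \<open>
  Comparing the components \<open>coord i\<close> at \<open>v = axis (coord l) 1\<close> gives the entries at \<open>(i, l)\<close>.
\<close>

lemma stationarity_to_mat:
  fixes A :: "real^'n::finite^'n" and L X :: "real^'r::finite^'n" and bs :: "(real^'n) list"
  assumes len: "length us = length bs"
    and eq: "\<And>v. A *v (X *v v) + (\<Sum>j<length bs. (us ! j \<bullet> v) *\<^sub>R bs ! j) + L *v v = 0"
  shows "to_mat A * to_mat X + (mat_of_row_list bs)\<^sup>T * mat_of_row_list us = - to_mat L"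
proof (rule eq_matI)
  fix i l assume "i < dim_row (- to_mat L)" "l < dim_col (- to_mat L)"
  then have i: "i < CARD('n)" and l: "l < CARD('r)" by (simp_all add: to_mat_def)
  let ?i = "coord i :: 'n" and ?l = "coord l :: 'r"
  have "(A *v (X *v axis ?l 1)) $ ?i = (\<Sum>a = 0..<CARD('n). A $ ?i $ coord a * X $ coord a $ ?l)"
    using sum_coord[of "\<lambda>a. A $ ?i $ a * X $ a $ ?l"]
    unfolding matrix_vector_mult_basis by (simp add: matrix_vector_mult_def column_def)
  moreover have "(L *v axis ?l 1) $ ?i = L $ ?i $ ?l"
    by (simp add: matrix_vector_mult_basis column_def)
  moreover have "(A *v (X *v axis ?l 1) + (\<Sum>j<length bs. (us ! j \<bullet> axis ?l 1) *\<^sub>R bs ! j) + L *v axis ?l 1) $ ?i = 0"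
    unfolding eq by simp
  ultimately show "(to_mat A * to_mat X + (mat_of_row_list bs)\<^sup>T * mat_of_row_list us) $$ (i, l) = (- to_mat L) $$ (i, l)"
    using i l len by (simp add: to_mat_def mat_of_row_list_def scalar_prod_def atLeast0LessThan inner_axis mult.commute)
qed (simp_all add: to_mat_def mat_of_row_list_def)

lemma linearized_constraints_to_mat:
  fixes X :: "real^'r::finite^'n::finite" and bs :: "(real^'n) list" and gs :: "(real^'r) list"
  assumes len: "length gs = length bs"
    and eq: "\<And>v j. j < length bs \<Longrightarrow> bs ! j \<bullet> (X *v v) + gs ! j \<bullet> v = 0"
  shows "mat_of_row_list bs * to_mat X = - mat_of_row_list gs"
proof (rule eq_matI)
  fix j l assume "j < dim_row (- mat_of_row_list gs)" "l < dim_col (- mat_of_row_list gs)"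
  then have j: "j < length bs" and l: "l < CARD('r)" using len by (simp_all add: mat_of_row_list_def)
  let ?l = "coord l :: 'r"
  have "bs ! j \<bullet> (X *v axis ?l 1) = (\<Sum>a = 0..<CARD('n). bs ! j $ coord a * X $ coord a $ ?l)"
    using sum_coord[of "\<lambda>a. bs ! j $ a * X $ a $ ?l"]
    by (simp add: matrix_vector_mult_basis column_def inner_vec_def)
  with eq[OF j, of "axis ?l 1"]
  show "(mat_of_row_list bs * to_mat X) $$ (j, l) = (- mat_of_row_list gs) $$ (j, l)"
    using j l len by (simp add: to_mat_def mat_of_row_list_def scalar_prod_def inner_axis)
qed (use len in \<open>simp_all add: to_mat_def mat_of_row_list_def\<close>)

section \<open>Partial gradients\<close>

text \<open>
  Uncurried in the point and the parameter, because it has to be differentiated jointly in both.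
\<close>

definition grad_x :: "(real^'n \<Rightarrow> real^'r \<Rightarrow> real) \<Rightarrow> (real^'n) \<times> (real^'r) \<Rightarrow> real^'n" where
  "grad_x \<phi> z = grad (\<lambda>y. \<phi> y (snd z)) (fst z)"

lemma grad_inner:
  assumes "(\<psi> has_derivative \<psi>') (at z)"
  shows "grad \<psi> z \<bullet> u = \<psi>' u"
proof -
  have lin: "linear \<psi>'"
    using assms has_derivative_linear by blast
  have "\<psi>' u = \<psi>' (\<Sum>i\<in>UNIV. u $ i *\<^sub>R axis i 1)"
    using basis_expansion[of u] by (simp add: scalar_mult_eq_scaleR)
  also have "\<dots> = (\<Sum>i\<in>UNIV. u $ i * \<psi>' (axis i 1))"
    by (simp add: linear_sum[OF lin] linear_scale[OF lin])
  finally show ?thesis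
    using frechet_derivative_at[OF assms] by (simp add: grad_def inner_vec_def mult.commute)
qed

lemma jacobian_mult:
  fixes F :: "real^'a \<Rightarrow> real^'b"
  assumes "(F has_derivative F') (at z)"
  shows "jacobian F (at z) *v u = F' u"
proof -
  have "F differentiable at z"
    using assms differentiable_def by blast
  then have "(F has_derivative (\<lambda>h. jacobian F (at z) *v h)) (at z)"
    by (simp add: jacobian_works)
  from has_derivative_unique[OF this assms] show ?thesis by (rule fun_cong)
qed

lemma has_derivative_partial_x:
  assumes "(F has_derivative F') (at (x, \<xi>))"
  shows "((\<lambda>y. F (y, \<xi>)) has_derivative (\<lambda>u. F' (u, 0))) (at x)"
  by (rule has_derivative_compose[OF has_derivative_Pair[OF has_derivative_ident has_derivative_const] assms])

lemma has_derivative_partial_\<xi>: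
  assumes "(F has_derivative F') (at (x, \<xi>))"
  shows "((\<lambda>\<eta>. F (x, \<eta>)) has_derivative (\<lambda>v. F' (0, v))) (at \<xi>)"
  by (rule has_derivative_compose[OF has_derivative_Pair[OF has_derivative_const has_derivative_ident] assms])

lemma grad_partial_inner:
  assumes "C1_on (UNIV \<times> N) (\<lambda>(x, \<xi>). \<phi> x \<xi>)" "open N" "\<xi> \<in> N"
  shows grad_x_inner: "grad_x \<phi> (x, \<xi>) \<bullet> u = fderiv (\<lambda>(x, \<xi>). \<phi> x \<xi>) (x, \<xi>) (u, 0)"
    and grad_\<xi>_inner: "grad (\<lambda>\<eta>. \<phi> x \<eta>) \<xi> \<bullet> v = fderiv (\<lambda>(x, \<xi>). \<phi> x \<xi>) (x, \<xi>) (0, v)"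
proof -
  have "((\<lambda>(x, \<xi>). \<phi> x \<xi>) has_derivative fderiv (\<lambda>(x, \<xi>). \<phi> x \<xi>) (x, \<xi>)) (at (x, \<xi>))"
    by (rule C1_on_has_fderiv[OF assms(1)]) (use assms(2,3) in \<open>auto simp: open_Times\<close>)
  then show "grad_x \<phi> (x, \<xi>) \<bullet> u = fderiv (\<lambda>(x, \<xi>). \<phi> x \<xi>) (x, \<xi>) (u, 0)"
    "grad (\<lambda>\<eta>. \<phi> x \<eta>) \<xi> \<bullet> v = fderiv (\<lambda>(x, \<xi>). \<phi> x \<xi>) (x, \<xi>) (0, v)"
    using grad_inner[OF has_derivative_partial_x] grad_inner[OF has_derivative_partial_\<xi>]
    by (fastforce simp: grad_x_def)+
qed

lemma C2_on_C1_on_fderiv: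
  assumes "C2_on S f" "open S"
  shows "C1_on S (fderiv f)"
proof -
  obtain f' where f': "\<forall>z\<in>S. (f has_derivative blinfun_apply (f' z)) (at z within S)" "C1_on S f'"
    using assms(1) unfolding C2_on_def by blast
  show ?thesis
  proof (rule C1_on_cong[OF f'(2)])
    fix z assume z: "z \<in> S"
    with f'(1) have "(f has_derivative blinfun_apply (f' z)) (at z)"
      using at_within_open[OF z assms(2)] by metis
    then show "f' z = fderiv f z" by (simp add: fderiv_eq)
  qed
qed

lemma C1_on_grad_x:
  fixes \<phi> :: "real^'n \<Rightarrow> real^'r \<Rightarrow> real"
  assumes \<phi>: "C2_on (UNIV \<times> N) (\<lambda>(x, \<xi>). \<phi> x \<xi>)" and N: "open N"
  shows "C1_on (UNIV \<times> N) (grad_x \<phi>)"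
proof -
  let ?D = "fderiv (\<lambda>(x, \<xi>). \<phi> x \<xi>)"
  have D: "C1_on (UNIV \<times> N) ?D"
    by (rule C2_on_C1_on_fderiv[OF \<phi>]) (simp add: N open_Times)
  have "C1_on (UNIV \<times> N) (\<lambda>z. \<Sum>i\<in>UNIV. ?D z (axis i 1, 0) *\<^sub>R axis i (1::real))"
    by (intro C1_on_sum C1_on_scaleR C1_on_const
        C1_on_compose[OF C1_on_bounded_linear[OF blinfun.bounded_linear_left] D, of UNIV]) auto
  then show ?thesis
  proof (rule C1_on_cong)
    fix z :: "(real^'n) \<times> (real^'r)" assume z: "z \<in> UNIV \<times> N"
    have "grad_x \<phi> z $ i = ?D z (axis i 1, 0)" for i
      using grad_x_inner[OF C2_on_imp_C1_on[OF \<phi>] N, of "snd z" "fst z" "axis i 1"] z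
      by (simp add: inner_axis mem_Times_iff)
    then show "(\<Sum>i\<in>UNIV. ?D z (axis i 1, 0) *\<^sub>R axis i (1::real)) = grad_x \<phi> z"
      using basis_expansion[of "grad_x \<phi> z"] by (simp add: scalar_mult_eq_scaleR)
  qed
qed

lemma independent_family:
  assumes "finite J" "inj_on b J" "independent (b ` J)" "(\<Sum>j\<in>J. a j *\<^sub>R b j) = 0" "j \<in> J"
  shows "a j = 0"
proof -
  have "(\<Sum>v\<in>b ` J. a (the_inv_into J b v) *\<^sub>R v) = 0"
    using assms(2,4) by (simp add: sum.reindex the_inv_into_f_f cong: sum.cong)
  then have "a (the_inv_into J b (b j)) = 0"
    by (intro independentD[OF assms(3) _ subset_refl]) (use assms(1,5) in auto)
  then show ?thesis using assms(2,5) by (simp add: the_inv_into_f_f)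
qed

text \<open>
  The quadratic form at \<open>a\<close> has a positive minimum \<open>e\<close> on the compact unit sphere, and an operator
  at distance less than \<open>e\<close> changes the form there by less than \<open>e\<close>.
\<close>

lemma positive_on_neighborhood:
  fixes H :: "'b::metric_space \<Rightarrow> ('a::euclidean_space \<times> 'c::real_normed_vector) \<Rightarrow>\<^sub>L 'a"
  assumes N: "open N" "a \<in> N" and cont: "continuous_on N H"
    and pos: "\<And>u. u \<noteq> 0 \<Longrightarrow> u \<bullet> H a (u, 0) > 0"
  obtains M where "open M" "a \<in> M" "M \<subseteq> N" "\<And>t u. t \<in> M \<Longrightarrow> u \<noteq> 0 \<Longrightarrow> u \<bullet> H t (u, 0) > 0"
proof -
  have "sphere (0::'a) 1 \<noteq> {}" by simp
  moreover have "continuous_on (sphere (0::'a) 1) (\<lambda>u. u \<bullet> H a (u, 0))"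
    by (intro continuous_intros)
  ultimately obtain u0 :: 'a where "u0 \<in> sphere 0 1"
    and "\<forall>u\<in>sphere 0 1. u0 \<bullet> H a (u0, 0) \<le> u \<bullet> H a (u, 0)"
    using continuous_attains_inf[OF compact_sphere] by blast
  then have u0: "norm u0 = 1" and min: "\<And>u. norm u = 1 \<Longrightarrow> u0 \<bullet> H a (u0, 0) \<le> u \<bullet> H a (u, 0)"
    by simp_all
  define e where "e = u0 \<bullet> H a (u0, 0)"
  have e: "e > 0" unfolding e_def using u0 by (intro pos) auto
  have "isCont H a" using N cont by (simp add: continuous_on_eq_continuous_at)
  then have "\<forall>\<^sub>F t in nhds a. dist (H t) (H a) < e"
    using e by (simp add: eventually_nhds_conv_at isCont_def tendsto_iff)
  moreover have "\<forall>\<^sub>F t in nhds a. t \<in> N"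
    using N by (rule eventually_nhds_in_open)
  ultimately have "\<forall>\<^sub>F t in nhds a. t \<in> N \<and> dist (H t) (H a) < e"
    by eventually_elim simp
  then obtain M where M: "open M" "a \<in> M" "\<And>t. t \<in> M \<Longrightarrow> t \<in> N \<and> dist (H t) (H a) < e"
    unfolding eventually_nhds by blast
  show ?thesis
  proof (rule that[OF M(1,2)])
    show "M \<subseteq> N" using M(3) by blast
    fix t and u :: 'a assume t: "t \<in> M" and u: "u \<noteq> 0"
    define r where "r = norm u"
    define w where "w = u /\<^sub>R r"
    have r: "r > 0" and w: "norm w = 1" and u_eq: "u = r *\<^sub>R w"
      using u by (simp_all add: w_def r_def)
    have "\<bar>w \<bullet> (H t - H a) (w, 0)\<bar> \<le> norm w * (norm (H t - H a) * norm (w, 0::'c))"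
      by (meson Cauchy_Schwarz_ineq2 mult_left_mono norm_blinfun norm_ge_zero order_trans)
    then have "\<bar>w \<bullet> (H t - H a) (w, 0)\<bar> < e"
      using M(3)[OF t] w by (simp add: norm_Pair dist_norm)
    moreover have "e \<le> w \<bullet> H a (w, 0)" unfolding e_def by (rule min[OF w])
    ultimately have w_pos: "w \<bullet> H t (w, 0) > 0"
      by (simp add: blinfun.diff_left inner_diff_right)
    have "H t (u, 0) = r *\<^sub>R H t (w, 0)"
      using blinfun.scaleR_right[of "H t" r "(w, 0)"] by (simp add: u_eq)
    then have "u \<bullet> H t (u, 0) = r * (r * (w \<bullet> H t (w, 0)))"
      by (simp add: u_eq)
    then show "u \<bullet> H t (u, 0) > 0" using r w_pos by simp
  qed
qed

section \<open>Branches of Karush-Kuhn-Tucker points\<close>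

text \<open>
  The gradient of the Lagrangian with the multipliers held fixed and a single indexed family \<open>c\<close> of
  equality constraints, as a function of the point and the parameter.
\<close>

definition lagr_grad where
  "lagr_grad f c J \<nu> z = grad_x f z + (\<Sum>j\<in>J. \<nu> j *\<^sub>R grad_x (c j) z)"

text \<open>
  A continuous branch of critical points of an equality constrained problem with independent
  constraint gradients. Once the active set is known to be constant, the active inequality
  constraints belong to the family \<open>c\<close> on the same footing as the equality constraints.
\<close>

locale kkt_branch =
  fixes f :: "real^'n::finite \<Rightarrow> real^'r::finite \<Rightarrow> real"
    and c :: "'j \<Rightarrow> real^'n \<Rightarrow> real^'r \<Rightarrow> real"
    and J :: "'j set" and N :: "(real^'r) set"
    and x :: "real^'r \<Rightarrow> real^'n" and \<nu> :: "real^'r \<Rightarrow> 'j \<Rightarrow> real"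
  assumes finite_J: "finite J" and open_N: "open N"
    and f_C2: "C2_on (UNIV \<times> N) (\<lambda>(x, \<xi>). f x \<xi>)"
    and c_C2: "j \<in> J \<Longrightarrow> C2_on (UNIV \<times> N) (\<lambda>(x, \<xi>). c j x \<xi>)"
    and x_cont: "continuous_on N x"
    and \<nu>_cont: "j \<in> J \<Longrightarrow> continuous_on N (\<lambda>\<xi>. \<nu> \<xi> j)"
    and stationary: "\<xi> \<in> N \<Longrightarrow> lagr_grad f c J (\<nu> \<xi>) (x \<xi>, \<xi>) = 0"
    and feasible: "\<xi> \<in> N \<Longrightarrow> j \<in> J \<Longrightarrow> c j (x \<xi>) \<xi> = 0"
    and inj: "\<xi> \<in> N \<Longrightarrow> inj_on (\<lambda>j. grad_x (c j) (x \<xi>, \<xi>)) J"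
    and indep: "\<xi> \<in> N \<Longrightarrow> independent ((\<lambda>j. grad_x (c j) (x \<xi>, \<xi>)) ` J)"
begin

text \<open>
  \<open>H \<xi>\<close> carries both second derivatives of the Lagrangian at the branch point: restricted to
  directions \<open>(u, 0)\<close> it is the Hessian \<open>A\<close>, restricted to directions \<open>(0, v)\<close> it is \<open>L\<close>.
\<close>

definition H :: "real^'r \<Rightarrow> ((real^'n) \<times> (real^'r)) \<Rightarrow>\<^sub>L (real^'n)" where
  "H \<xi> = fderiv (lagr_grad f c J (\<nu> \<xi>)) (x \<xi>, \<xi>)"

lemma open_Times_N: "open (UNIV \<times> N :: ((real^'n) \<times> (real^'r)) set)"
  using open_N by (simp add: open_Times)

lemma grad_x_f_has_derivative: "\<xi> \<in> N \<Longrightarrow> (grad_x f has_derivative fderiv (grad_x f) (y, \<xi>)) (at (y, \<xi>))"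
  by (rule C1_on_has_fderiv[OF C1_on_grad_x[OF f_C2 open_N] open_Times_N]) simp

lemma grad_x_c_has_derivative: "\<xi> \<in> N \<Longrightarrow> j \<in> J \<Longrightarrow> (grad_x (c j) has_derivative fderiv (grad_x (c j)) (y, \<xi>)) (at (y, \<xi>))"
  by (rule C1_on_has_fderiv[OF C1_on_grad_x[OF c_C2 open_N] open_Times_N]) simp_all

lemma c_has_derivative: "\<xi> \<in> N \<Longrightarrow> j \<in> J \<Longrightarrow>
    ((\<lambda>(x, \<xi>). c j x \<xi>) has_derivative fderiv (\<lambda>(x, \<xi>). c j x \<xi>) (y, \<xi>)) (at (y, \<xi>))"
  by (rule C1_on_has_fderiv[OF C2_on_imp_C1_on[OF c_C2] open_Times_N]) simp_all

lemma lagr_grad_has_derivative: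
  assumes "\<xi> \<in> N"
  shows "(lagr_grad f c J \<mu> has_derivative
    fderiv (grad_x f) (y, \<xi>) + (\<Sum>j\<in>J. \<mu> j *\<^sub>R fderiv (grad_x (c j)) (y, \<xi>))) (at (y, \<xi>))"
proof -
  have "((\<lambda>z. grad_x f z + (\<Sum>j\<in>J. \<mu> j *\<^sub>R grad_x (c j) z)) has_derivative
    (\<lambda>d. fderiv (grad_x f) (y, \<xi>) d + (\<Sum>j\<in>J. \<mu> j *\<^sub>R fderiv (grad_x (c j)) (y, \<xi>) d))) (at (y, \<xi>))"
    by (intro has_derivative_add has_derivative_sum has_derivative_scaleR_right grad_x_f_has_derivative grad_x_c_has_derivative assms)
  moreover have "blinfun_apply (fderiv (grad_x f) (y, \<xi>) + (\<Sum>j\<in>J. \<mu> j *\<^sub>R fderiv (grad_x (c j)) (y, \<xi>)))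
      = (\<lambda>d. fderiv (grad_x f) (y, \<xi>) d + (\<Sum>j\<in>J. \<mu> j *\<^sub>R fderiv (grad_x (c j)) (y, \<xi>) d))"
    by (auto simp: blinfun.add_left blinfun.sum_left blinfun.scaleR_left)
  ultimately show ?thesis
    by (simp only: lagr_grad_def[abs_def])
qed

lemma H_eq:
  assumes "\<xi> \<in> N"
  shows "H \<xi> = fderiv (grad_x f) (x \<xi>, \<xi>) + (\<Sum>j\<in>J. \<nu> \<xi> j *\<^sub>R fderiv (grad_x (c j)) (x \<xi>, \<xi>))"
  unfolding H_def by (rule fderiv_eq[OF lagr_grad_has_derivative[OF assms]])

lemma H_has_derivative:
  assumes "\<xi> \<in> N"
  shows "(lagr_grad f c J (\<nu> \<xi>) has_derivative H \<xi>) (at (x \<xi>, \<xi>))"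
  unfolding H_eq[OF assms] by (rule lagr_grad_has_derivative[OF assms])

lemma continuous_on_H: "continuous_on N H"
proof -
  have cont: "continuous_on N (\<lambda>\<xi>. fderiv (grad_x \<phi>) (x \<xi>, \<xi>))"
    if "C2_on (UNIV \<times> N) (\<lambda>(x, \<xi>). \<phi> x \<xi>)" for \<phi> :: "real^'n \<Rightarrow> real^'r \<Rightarrow> real"
    by (rule continuous_on_compose2[OF C1_on_continuous_fderiv[OF C1_on_grad_x[OF that open_N] open_Times_N]])
       (auto intro!: continuous_intros x_cont)
  have "continuous_on N (\<lambda>\<xi>. fderiv (grad_x f) (x \<xi>, \<xi>) + (\<Sum>j\<in>J. \<nu> \<xi> j *\<^sub>R fderiv (grad_x (c j)) (x \<xi>, \<xi>)))"
    by (intro continuous_intros cont f_C2 c_C2 \<nu>_cont)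
  then show ?thesis
    by (rule continuous_on_eq) (simp add: H_eq)
qed

lemma card_J_le:
  assumes "\<xi> \<in> N"
  shows "card J \<le> CARD('n)"
  using independent_bound[OF indep[OF assms]] card_image[OF inj[OF assms]] by simp

text \<open>
  The number of multipliers varies, whereas \<open>implicit_C1\<close> wants the unknown in a fixed Euclidean
  space. Independence of the gradients bounds the number of constraints by the dimension of \<open>x\<close>, so
  the multipliers fit into a second copy \<open>w\<close> of that space: an injection \<open>\<sigma>\<close> places multiplier \<open>j\<close> in
  coordinate \<open>\<sigma> j\<close>. The second component of the system \<open>F\<close> reads \<open>c j x \<xi> = 0\<close> in coordinate \<open>\<sigma> j\<close> and
  \<open>w $ i = 0\<close> in each remaining coordinate \<open>i\<close>.
\<close>

lemma kkt_branch_C1: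
  assumes pos: "\<And>\<xi> u. \<xi> \<in> N \<Longrightarrow> u \<noteq> 0 \<Longrightarrow> u \<bullet> H \<xi> (u, 0) > 0"
  shows x_C1: "C1_on N x" and \<nu>_C1: "j \<in> J \<Longrightarrow> C1_on N (\<lambda>\<xi>. \<nu> \<xi> j)"
proof -
  have "C1_on N x \<and> (\<forall>j\<in>J. C1_on N (\<lambda>\<xi>. \<nu> \<xi> j))"
  proof (cases "N = {}")
    case True
    then show ?thesis by (simp add: C1_on_def)
  next
    case False
    then have "card J \<le> card (UNIV :: 'n set)" using card_J_le by auto
    then obtain \<sigma> :: "'j \<Rightarrow> 'n" where \<sigma>: "inj_on \<sigma> J"
      using card_le_inj[OF finite_J finite] by blast
    have axis_\<sigma>: "(\<Sum>j\<in>J. a j *\<^sub>R axis (\<sigma> j) (1::real)) $ i = (if i \<in> \<sigma> ` J then a (the_inv_into J \<sigma> i) else 0)"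
      for a i
    proof (cases "i \<in> \<sigma> ` J")
      case True
      then obtain k where k: "k \<in> J" "i = \<sigma> k" by auto
      have "(\<Sum>j\<in>J. a j *\<^sub>R axis (\<sigma> j) (1::real)) $ i = (\<Sum>j\<in>J. if j = k then a j else 0)"
        using k inj_onD[OF \<sigma>] by (auto simp: axis_def intro!: sum.cong)
      then show ?thesis using k \<sigma> finite_J by (simp add: the_inv_into_f_f)
    qed (auto simp: axis_def intro!: sum.neutral)
    define z where "z \<xi> = (x \<xi>, \<Sum>j\<in>J. \<nu> \<xi> j *\<^sub>R axis (\<sigma> j) (1::real))" for \<xi>
    define F :: "((real^'n) \<times> (real^'n)) \<times> (real^'r) \<Rightarrow> (real^'n) \<times> (real^'n)" where
      "F q = (grad_x f (fst (fst q), snd q)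
                + (\<Sum>j\<in>J. (snd (fst q) $ \<sigma> j) *\<^sub>R grad_x (c j) (fst (fst q), snd q)),
              snd (fst q) - (\<Sum>j\<in>J. (snd (fst q) $ \<sigma> j - c j (fst (fst q)) (snd q)) *\<^sub>R axis (\<sigma> j) 1))" for q
    have z_simps: "fst (z \<xi>) = x \<xi>" "snd (z \<xi>) = (\<Sum>j\<in>J. \<nu> \<xi> j *\<^sub>R axis (\<sigma> j) 1)" for \<xi>
      by (simp_all add: z_def)
    have z_\<sigma>: "snd (z \<xi>) $ \<sigma> j = \<nu> \<xi> j" if "j \<in> J" for \<xi> j
      unfolding z_simps using that \<sigma> axis_\<sigma>[of "\<nu> \<xi>" "\<sigma> j"]
      by (simp add: the_inv_into_f_f del: sum_component)
    have z_zero: "F (z \<xi>, \<xi>) = 0" if "\<xi> \<in> N" for \<xi>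
    proof -
      have "fst (F (z \<xi>, \<xi>)) = lagr_grad f c J (\<nu> \<xi>) (x \<xi>, \<xi>)"
        by (simp add: F_def lagr_grad_def z_\<sigma> z_simps(1))
      moreover have "snd (F (z \<xi>, \<xi>)) = snd (z \<xi>) - (\<Sum>j\<in>J. \<nu> \<xi> j *\<^sub>R axis (\<sigma> j) 1)"
        using that by (simp add: F_def z_\<sigma> feasible z_simps(1))
      ultimately show ?thesis using stationary[OF that] by (simp add: prod_eq_iff z_simps(2))
    qed
    have z_cont: "continuous_on N z"
      unfolding z_def[abs_def] by (intro continuous_intros x_cont \<nu>_cont)
    have bl: "bounded_linear (\<lambda>q :: ((real^'n) \<times> (real^'n)) \<times> (real^'r). (fst (fst q), snd q))"
      "bounded_linear (\<lambda>q :: ((real^'n) \<times> (real^'n)) \<times> (real^'r). snd (fst q))"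
      "bounded_linear (\<lambda>q :: ((real^'n) \<times> (real^'n)) \<times> (real^'r). snd (fst q) $ i)" for i
      by (auto intro!: bounded_linear_Pair bounded_linear_fst_comp bounded_linear_snd_comp
          bounded_linear_compose[OF bounded_linear_vec_nth] bounded_linear_ident)
    have comp: "C1_on (UNIV \<times> N) (\<lambda>q :: ((real^'n) \<times> (real^'n)) \<times> (real^'r). \<phi> (fst (fst q), snd q))"
      if "C1_on (UNIV \<times> N) \<phi>" for \<phi> :: "(real^'n) \<times> (real^'r) \<Rightarrow> 'b::real_normed_vector"
      by (rule C1_on_compose[OF that C1_on_bounded_linear[OF bl(1)]]) auto
    have F_C1: "C1_on (UNIV \<times> N) F"
      unfolding F_def[abs_def]
      by (intro C1_on_Pair C1_on_add C1_on_sum C1_on_scaleR C1_on_diff C1_on_const C1_on_bounded_linear bl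
          comp[OF C1_on_grad_x[OF f_C2 open_N]] comp[OF C1_on_grad_x[OF c_C2 open_N]]
          comp[OF C2_on_imp_C1_on[OF c_C2], unfolded prod.case])
    \<comment> \<open>The KKT matrix, extended by the identity on the coordinates outside the range of \<open>\<sigma>\<close>.\<close>
    have F': "fderiv F (z \<xi>, \<xi>) ((u, \<eta>), 0) =
        (H \<xi> (u, 0) + (\<Sum>j\<in>J. (\<eta> $ \<sigma> j) *\<^sub>R grad_x (c j) (x \<xi>, \<xi>)),
         \<eta> - (\<Sum>j\<in>J. (\<eta> $ \<sigma> j - grad_x (c j) (x \<xi>, \<xi>) \<bullet> u) *\<^sub>R axis (\<sigma> j) 1))" if \<xi>: "\<xi> \<in> N" for \<xi> u \<eta>
    proof -
      have comp': "((\<lambda>q. \<phi> (fst (fst q), snd q)) has_derivative (\<lambda>d. \<phi>' (fst (fst d), snd d))) (at (z \<xi>, \<xi>))"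
        if "(\<phi> has_derivative \<phi>') (at (x \<xi>, \<xi>))" for \<phi> :: "(real^'n) \<times> (real^'r) \<Rightarrow> 'b::real_normed_vector" and \<phi>'
        by (rule has_derivative_compose[OF bounded_linear_imp_has_derivative[OF bl(1)]])
           (use that in \<open>simp add: z_simps(1)\<close>)
      have "(F has_derivative (\<lambda>d.
         (fderiv (grad_x f) (x \<xi>, \<xi>) (fst (fst d), snd d)
           + (\<Sum>j\<in>J. (snd (fst (z \<xi>, \<xi>)) $ \<sigma> j) *\<^sub>R fderiv (grad_x (c j)) (x \<xi>, \<xi>) (fst (fst d), snd d)
               + (snd (fst d) $ \<sigma> j) *\<^sub>R grad_x (c j) (fst (fst (z \<xi>, \<xi>)), snd (z \<xi>, \<xi>))),
          snd (fst d) - (\<Sum>j\<in>J. (snd (fst d) $ \<sigma> j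
               - fderiv (\<lambda>(x, \<xi>). c j x \<xi>) (x \<xi>, \<xi>) (fst (fst d), snd d)) *\<^sub>R axis (\<sigma> j) 1))))
        (at (z \<xi>, \<xi>))"
        unfolding F_def[abs_def]
        by (intro has_derivative_Pair has_derivative_add has_derivative_sum has_derivative_scaleR has_derivative_diff
            has_derivative_scaleR_left bounded_linear_imp_has_derivative[OF bl(2)] bounded_linear_imp_has_derivative[OF bl(3)]
            comp'[OF grad_x_f_has_derivative[OF \<xi>]] comp'[OF grad_x_c_has_derivative[OF \<xi>]] comp'[OF c_has_derivative[OF \<xi>], unfolded prod.case])
      moreover have "(F has_derivative fderiv F (z \<xi>, \<xi>)) (at (z \<xi>, \<xi>))"
        by (rule C1_on_has_fderiv[OF F_C1]) (use \<xi> open_N in \<open>auto simp: open_Times\<close>)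
      ultimately have "fderiv F (z \<xi>, \<xi>) ((u, \<eta>), 0) =
         (fderiv (grad_x f) (x \<xi>, \<xi>) (u, 0)
           + (\<Sum>j\<in>J. \<nu> \<xi> j *\<^sub>R fderiv (grad_x (c j)) (x \<xi>, \<xi>) (u, 0) + (\<eta> $ \<sigma> j) *\<^sub>R grad_x (c j) (x \<xi>, \<xi>)),
          \<eta> - (\<Sum>j\<in>J. (\<eta> $ \<sigma> j - fderiv (\<lambda>(x, \<xi>). c j x \<xi>) (x \<xi>, \<xi>) (u, 0)) *\<^sub>R axis (\<sigma> j) 1))"
        using has_derivative_unique[of F _ "(z \<xi>, \<xi>)" "fderiv F (z \<xi>, \<xi>)"]
        by (simp add: z_\<sigma> z_simps(1))
      then show ?thesis
        by (simp add: H_eq[OF \<xi>] blinfun.add_left blinfun.sum_left blinfun.scaleR_left sum.distrib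
            grad_x_inner[OF C2_on_imp_C1_on[OF c_C2] open_N \<xi>])
    qed
    have "C1_on N z"
    proof (rule implicit_C1[OF open_N F_C1 z_cont z_zero])
      fix \<xi> and q :: "(real^'n) \<times> (real^'n)"
      assume \<xi>: "\<xi> \<in> N" and q: "fderiv F (z \<xi>, \<xi>) (q, 0) = 0"
      obtain u \<eta> where q_eq: "q = (u, \<eta>)" by fastforce
      let ?b = "\<lambda>j. grad_x (c j) (x \<xi>, \<xi>)"
      have first: "H \<xi> (u, 0) + (\<Sum>j\<in>J. (\<eta> $ \<sigma> j) *\<^sub>R ?b j) = 0"
        and second: "\<eta> = (\<Sum>j\<in>J. (\<eta> $ \<sigma> j - ?b j \<bullet> u) *\<^sub>R axis (\<sigma> j) 1)"
        using q F'[OF \<xi>, of u \<eta>] by (simp_all add: q_eq zero_prod_def)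
      have \<eta>_i: "\<eta> $ i = (if i \<in> \<sigma> ` J then \<eta> $ \<sigma> (the_inv_into J \<sigma> i) - ?b (the_inv_into J \<sigma> i) \<bullet> u else 0)" for i
        by (subst second) (rule axis_\<sigma>)
      have bu: "?b j \<bullet> u = 0" if "j \<in> J" for j
        using \<eta>_i[of "\<sigma> j"] that \<sigma> by (simp add: the_inv_into_f_f)
      have "0 = u \<bullet> (H \<xi> (u, 0) + (\<Sum>j\<in>J. (\<eta> $ \<sigma> j) *\<^sub>R ?b j))"
        by (simp add: first)
      also have "\<dots> = u \<bullet> H \<xi> (u, 0)"
        by (simp add: inner_add_right inner_sum_right bu inner_commute[of u])
      finally have u: "u = 0" using pos[OF \<xi>, of u] by force
      then have "(\<Sum>j\<in>J. (\<eta> $ \<sigma> j) *\<^sub>R ?b j) = 0"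
        using first by (simp add: blinfun.zero_right flip: zero_prod_def)
      then have "\<eta> $ \<sigma> j = 0" if "j \<in> J" for j
        by (rule independent_family[OF finite_J inj[OF \<xi>] indep[OF \<xi>] _ that])
      then have "\<eta> $ i = 0" for i
        using \<eta>_i[of i] by (cases "i \<in> \<sigma> ` J") auto
      then have "\<eta> = 0" by (simp add: Finite_Cartesian_Product.vec_eq_iff)
      with u show "q = 0" by (simp add: q_eq zero_prod_def)
    qed
    have "C1_on N (\<lambda>\<xi>. fst (z \<xi>))"
      by (rule C1_on_compose[OF C1_on_bounded_linear[OF bounded_linear_fst, of UNIV] \<open>C1_on N z\<close>]) simp
    moreover have "C1_on N (\<lambda>\<xi>. snd (z \<xi>) $ \<sigma> j)" for j
      by (rule C1_on_compose[OF C1_on_bounded_linear[of "\<lambda>q. snd q $ \<sigma> j" UNIV] \<open>C1_on N z\<close>])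
         (auto intro!: bounded_linear_compose[OF bounded_linear_vec_nth] bounded_linear_snd)
    ultimately show ?thesis
      using C1_on_cong[OF \<open>C1_on N (\<lambda>\<xi>. fst (z \<xi>))\<close>, of x] C1_on_cong[of N "\<lambda>\<xi>. snd (z \<xi>) $ \<sigma> j" "\<lambda>\<xi>. \<nu> \<xi> j" for j]
      by (simp add: z_\<sigma> z_simps(1))
  qed
  then show "C1_on N x" "j \<in> J \<Longrightarrow> C1_on N (\<lambda>\<xi>. \<nu> \<xi> j)" by auto
qed

text \<open>
  Both identities hold throughout the open set \<open>N\<close>, so the chain rule may be applied to them.
\<close>

lemma kkt_branch_derivative:
  assumes x: "C1_on N x" and \<nu>: "\<And>j. j \<in> J \<Longrightarrow> C1_on N (\<lambda>\<xi>. \<nu> \<xi> j)" and \<xi>: "\<xi> \<in> N"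
  shows stationarity_derivative:
      "H \<xi> (fderiv x \<xi> v, v) + (\<Sum>j\<in>J. fderiv (\<lambda>\<xi>. \<nu> \<xi> j) \<xi> v *\<^sub>R grad_x (c j) (x \<xi>, \<xi>)) = 0"
    and feasibility_derivative:
      "j \<in> J \<Longrightarrow> grad_x (c j) (x \<xi>, \<xi>) \<bullet> fderiv x \<xi> v + grad (\<lambda>\<eta>. c j (x \<xi>) \<eta>) \<xi> \<bullet> v = 0"
proof -
  have path: "((\<lambda>\<eta>. (x \<eta>, \<eta>)) has_derivative (\<lambda>v. (fderiv x \<xi> v, v))) (at \<xi>)"
    by (intro has_derivative_Pair has_derivative_ident C1_on_has_fderiv[OF x open_N \<xi>])
  have "((\<lambda>\<eta>. lagr_grad f c J (\<nu> \<eta>) (x \<eta>, \<eta>)) has_derivative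
     (\<lambda>v. fderiv (grad_x f) (x \<xi>, \<xi>) (fderiv x \<xi> v, v) +
      (\<Sum>j\<in>J. \<nu> \<xi> j *\<^sub>R fderiv (grad_x (c j)) (x \<xi>, \<xi>) (fderiv x \<xi> v, v)
          + fderiv (\<lambda>\<xi>. \<nu> \<xi> j) \<xi> v *\<^sub>R grad_x (c j) (x \<xi>, \<xi>)))) (at \<xi>)"
    unfolding lagr_grad_def
    by (intro has_derivative_add has_derivative_sum has_derivative_scaleR
        has_derivative_compose[OF path grad_x_f_has_derivative[OF \<xi>]] has_derivative_compose[OF path grad_x_c_has_derivative[OF \<xi>]]
        C1_on_has_fderiv[OF \<nu> open_N \<xi>])
  moreover have "((\<lambda>\<eta>. lagr_grad f c J (\<nu> \<eta>) (x \<eta>, \<eta>)) has_derivative (\<lambda>v. 0)) (at \<xi>)"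
    by (rule has_derivative_transform_within_open[OF has_derivative_const open_N \<xi>, of 0]) (simp add: stationary)
  ultimately have "(\<lambda>v. fderiv (grad_x f) (x \<xi>, \<xi>) (fderiv x \<xi> v, v) +
      (\<Sum>j\<in>J. \<nu> \<xi> j *\<^sub>R fderiv (grad_x (c j)) (x \<xi>, \<xi>) (fderiv x \<xi> v, v)
          + fderiv (\<lambda>\<xi>. \<nu> \<xi> j) \<xi> v *\<^sub>R grad_x (c j) (x \<xi>, \<xi>))) = (\<lambda>v. 0)"
    by (rule has_derivative_unique)
  from fun_cong[OF this, of v]
  show "H \<xi> (fderiv x \<xi> v, v) + (\<Sum>j\<in>J. fderiv (\<lambda>\<xi>. \<nu> \<xi> j) \<xi> v *\<^sub>R grad_x (c j) (x \<xi>, \<xi>)) = 0"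
    by (simp add: H_eq[OF \<xi>] blinfun.add_left blinfun.sum_left blinfun.scaleR_left sum.distrib add.assoc)
next
  assume j: "j \<in> J"
  let ?D = "fderiv (\<lambda>(x, \<xi>). c j x \<xi>) (x \<xi>, \<xi>)"
  have path: "((\<lambda>\<eta>. (x \<eta>, \<eta>)) has_derivative (\<lambda>v. (fderiv x \<xi> v, v))) (at \<xi>)"
    by (intro has_derivative_Pair has_derivative_ident C1_on_has_fderiv[OF x open_N \<xi>])
  have "((\<lambda>\<eta>. c j (x \<eta>) \<eta>) has_derivative (\<lambda>v. ?D (fderiv x \<xi> v, v))) (at \<xi>)"
    using has_derivative_compose[OF path c_has_derivative[OF \<xi> j]] by simp
  moreover have "((\<lambda>\<eta>. c j (x \<eta>) \<eta>) has_derivative (\<lambda>v. 0)) (at \<xi>)"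
    by (rule has_derivative_transform_within_open[OF has_derivative_const open_N \<xi>, of 0]) (simp add: feasible j)
  ultimately have "(\<lambda>v. ?D (fderiv x \<xi> v, v)) = (\<lambda>v. 0)"
    by (rule has_derivative_unique)
  from fun_cong[OF this, of v] have "?D ((fderiv x \<xi> v, 0) + (0, v)) = 0"
    by simp
  then show "grad_x (c j) (x \<xi>, \<xi>) \<bullet> fderiv x \<xi> v + grad (\<lambda>\<eta>. c j (x \<xi>) \<eta>) \<xi> \<bullet> v = 0"
    unfolding blinfun.add_right
    by (simp add: grad_x_inner[OF C2_on_imp_C1_on[OF c_C2[OF j]] open_N \<xi>] grad_\<xi>_inner[OF C2_on_imp_C1_on[OF c_C2[OF j]] open_N \<xi>])
qed

text \<open>
  The list \<open>js\<close> fixes the order in which the constraints appear as rows.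
\<close>

lemma kkt_branch_formulas:
  fixes A :: "real^'n^'n" and L :: "real^'r^'n"
  assumes x: "C1_on N x" and \<nu>: "\<And>j. j \<in> J \<Longrightarrow> C1_on N (\<lambda>\<xi>. \<nu> \<xi> j)" and \<xi>: "\<xi> \<in> N"
    and js: "distinct js" "set js = J"
    and A: "\<And>u. A *v u = H \<xi> (u, 0)" and L: "\<And>v. L *v v = H \<xi> (0, v)" and pd: "pos_def A"
    and B: "B = mat_of_row_list (map (\<lambda>j. grad_x (c j) (x \<xi>, \<xi>)) js)"
    and G: "G = mat_of_row_list (map (\<lambda>j. grad (\<lambda>\<eta>. c j (x \<xi>) \<eta>) \<xi>) js)"
    and V: "V = mat_of_row_list (map (\<lambda>j. grad (\<lambda>\<eta>. \<nu> \<eta> j) \<xi>) js)"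
  shows "invertible_mat (to_mat A)" "invertible_mat (B * B\<^sup>T)"
    "invertible_mat (B * minv (to_mat A) * B\<^sup>T)"
    "to_mat (jacobian x (at \<xi>)) =
      - (Pi_mat (to_mat A) B * minv (to_mat A) * to_mat L) - Sigma_mat (to_mat A) B * pinv B * G"
    "V = - ((pinv B)\<^sup>T * to_mat A * Sigma_mat (to_mat A) B * (minv (to_mat A) * to_mat L - pinv B * G))"
proof -
  let ?b = "\<lambda>j. grad_x (c j) (x \<xi>, \<xi>)"
  let ?X = "jacobian x (at \<xi>)"
  have X: "?X *v v = fderiv x \<xi> v" for v
    by (rule jacobian_mult[OF C1_on_has_fderiv[OF x open_N \<xi>]])
  have u: "grad (\<lambda>\<eta>. \<nu> \<eta> j) \<xi> \<bullet> v = fderiv (\<lambda>\<eta>. \<nu> \<eta> j) \<xi> v" if "j \<in> J" for j v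
    by (rule grad_inner[OF C1_on_has_fderiv[OF \<nu>[OF that] open_N \<xi>]])
  have Bc: "B \<in> carrier_mat (length js) CARD('n)"
    unfolding B using mat_of_row_list_carrier[of "map ?b js"] by simp
  have Gc: "G \<in> carrier_mat (length js) CARD('r)"
    unfolding G using mat_of_row_list_carrier[of "map (\<lambda>j. grad (\<lambda>\<eta>. c j (x \<xi>) \<eta>) \<xi>) js"] by simp
  have Vc: "V \<in> carrier_mat (length js) CARD('r)"
    unfolding V using mat_of_row_list_carrier[of "map (\<lambda>j. grad (\<lambda>\<eta>. \<nu> \<eta> j) \<xi>) js"] by simp
  have rows: "w = 0\<^sub>v (length js)" if "w \<in> carrier_vec (length js)" "B\<^sup>T *\<^sub>v w = 0\<^sub>v CARD('n)" for w
  proof -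
    have "w = 0\<^sub>v (length (map ?b js))"
    proof (rule mat_of_row_list_transpose_kernel)
      fix a assume sum: "(\<Sum>i<length (map ?b js). a i *\<^sub>R map ?b js ! i) = 0"
      let ?a = "\<lambda>j. a (the_inv_into {..<length js} ((!) js) j)"
      have inj_nth: "inj_on ((!) js) {..<length js}"
        using js(1) by (auto simp: inj_on_def nth_eq_iff_index_eq)
      have "(\<Sum>j\<in>J. ?a j *\<^sub>R ?b j) = (\<Sum>i<length js. ?a (js ! i) *\<^sub>R ?b (js ! i))"
        using sum_nth_distinct[OF js(1), of "\<lambda>j. ?a j *\<^sub>R ?b j"] js(2) by simp
      also have "\<dots> = 0"
        using sum inj_nth by (simp add: the_inv_into_f_f)
      finally have "?a (js ! i) = 0" if "i < length js" for i
        using independent_family[OF finite_J inj[OF \<xi>] indep[OF \<xi>], of ?a "js ! i"] that js(2) by auto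
      then show "\<forall>i<length (map ?b js). a i = 0"
        using inj_nth by (simp add: the_inv_into_f_f)
    qed (use that in \<open>simp_all add: B\<close>)
    then show ?thesis by simp
  qed
  show iA: "invertible_mat (to_mat A)" by (rule pos_def_invertible[OF pd])
  show iH: "invertible_mat (B * B\<^sup>T)" by (rule gram_matrix_invertible[OF Bc rows])
  show iW: "invertible_mat (B * minv (to_mat A) * B\<^sup>T)"
    by (rule schur_complement_invertible[OF to_mat_carrier Bc iA to_mat_pos_def[OF pd] rows])
  have stat: "to_mat A * to_mat ?X + B\<^sup>T * V = - to_mat L"
    unfolding B V
  proof (rule stationarity_to_mat)
    fix v
    let ?T = "\<Sum>i<length (map ?b js). (map (\<lambda>j. grad (\<lambda>\<eta>. \<nu> \<eta> j) \<xi>) js ! i \<bullet> v) *\<^sub>R map ?b js ! i"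
    have T: "?T = (\<Sum>j\<in>J. fderiv (\<lambda>\<eta>. \<nu> \<eta> j) \<xi> v *\<^sub>R ?b j)"
      using sum_nth_distinct[OF js(1), of "\<lambda>j. (grad (\<lambda>\<eta>. \<nu> \<eta> j) \<xi> \<bullet> v) *\<^sub>R ?b j"] js(2) by (simp add: u)
    have AL: "A *v (?X *v v) + L *v v = H \<xi> (fderiv x \<xi> v, v)"
      unfolding A L X blinfun.add_right[symmetric] by simp
    have "A *v (?X *v v) + ?T + L *v v = (A *v (?X *v v) + L *v v) + ?T"
      by (simp only: ac_simps)
    also have "\<dots> = 0"
      unfolding AL T by (rule stationarity_derivative[OF x \<nu> \<xi>])
    finally show "A *v (?X *v v) + ?T + L *v v = 0" .
  qed simp
  have constr: "B * to_mat ?X = - G"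
    unfolding B G
    by (rule linearized_constraints_to_mat) (use feasibility_derivative[OF x \<nu> \<xi>] js(2) in \<open>auto simp: X\<close>)
  note sol = kkt_system_solution[OF to_mat_carrier Bc to_mat_carrier Gc to_mat_carrier Vc iA iH iW stat constr]
  show "to_mat ?X = - (Pi_mat (to_mat A) B * minv (to_mat A) * to_mat L) - Sigma_mat (to_mat A) B * pinv B * G"
    by (rule sol(1))
  show "V = - ((pinv B)\<^sup>T * to_mat A * Sigma_mat (to_mat A) B * (minv (to_mat A) * to_mat L - pinv B * G))"
    by (rule sol(2))
qed

end

section \<open>Sensitivity of regular minimizers\<close>

text \<open>
  Inequality constraints whose multipliers vanish do not contribute to the gradient of the
  Lagrangian, so they may be dropped from the family of constraints.
\<close>

lemma grad_x_lagrangian_eq: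
  fixes f :: "real^'n::finite \<Rightarrow> real^'r::finite \<Rightarrow> real" and h g :: "nat \<Rightarrow> real^'n \<Rightarrow> real^'r \<Rightarrow> real"
  assumes N: "open N" "\<xi> \<in> N"
    and f: "C1_on (UNIV \<times> N) (\<lambda>(x, \<xi>). f x \<xi>)"
    and h: "\<And>k. k < p \<Longrightarrow> C1_on (UNIV \<times> N) (\<lambda>(x, \<xi>). h k x \<xi>)"
    and g: "\<And>i. i < m \<Longrightarrow> C1_on (UNIV \<times> N) (\<lambda>(x, \<xi>). g i x \<xi>)"
    and I: "I \<subseteq> {..<m}" "\<And>i. i < m \<Longrightarrow> i \<notin> I \<Longrightarrow> mu i = 0"
  shows "grad_x_lagrangian f p h m g x lam mu \<xi>
    = lagr_grad f (case_sum h g) ({..<p} <+> I) (case_sum lam mu) (x, \<xi>)"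
proof -
  let ?D = "\<lambda>\<phi>. fderiv (\<lambda>(x, \<xi>). \<phi> x \<xi>) (x, \<xi>)"
  have d: "((\<lambda>y. \<phi> y \<xi>) has_derivative (\<lambda>u. ?D \<phi> (u, 0))) (at x)"
    if "C1_on (UNIV \<times> N) (\<lambda>(x, \<xi>). \<phi> x \<xi>)" for \<phi> :: "real^'n \<Rightarrow> real^'r \<Rightarrow> real"
    using has_derivative_partial_x[OF C1_on_has_fderiv[OF that]] N by (auto simp: open_Times)
  have "finite I" using I(1) finite_subset by blast
  have "((\<lambda>y. lagrangian f p h m g y lam mu \<xi>) has_derivative
     (\<lambda>u. ?D f (u, 0) + (\<Sum>k<p. lam k * ?D (h k) (u, 0)) + (\<Sum>i<m. mu i * ?D (g i) (u, 0)))) (at x)"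
    unfolding lagrangian_def
    by (intro has_derivative_add has_derivative_sum has_derivative_mult_right d f h g) auto
  from grad_inner[OF this]
  have "grad_x_lagrangian f p h m g x lam mu \<xi> \<bullet> u
    = (grad_x f (x, \<xi>) + (\<Sum>k<p. lam k *\<^sub>R grad_x (h k) (x, \<xi>)) + (\<Sum>i<m. mu i *\<^sub>R grad_x (g i) (x, \<xi>))) \<bullet> u"
    for u
    unfolding grad_x_lagrangian_def
    by (simp add: inner_add_left inner_sum_left grad_x_inner[OF f N] grad_x_inner[OF h N] grad_x_inner[OF g N])
  then have "grad_x_lagrangian f p h m g x lam mu \<xi>
    = grad_x f (x, \<xi>) + (\<Sum>k<p. lam k *\<^sub>R grad_x (h k) (x, \<xi>)) + (\<Sum>i<m. mu i *\<^sub>R grad_x (g i) (x, \<xi>))"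
    by (rule vector_eq_rdot[THEN iffD1, OF allI])
  also have "(\<Sum>i<m. mu i *\<^sub>R grad_x (g i) (x, \<xi>)) = (\<Sum>i\<in>I. mu i *\<^sub>R grad_x (g i) (x, \<xi>))"
    using I by (intro sum.mono_neutral_right) auto
  finally show ?thesis
    using \<open>finite I\<close> by (simp add: lagr_grad_def sum.Plus comp_def add.assoc)
qed

theorem proposition4:
  fixes f :: "real^'n::finite \<Rightarrow> real^'r::finite \<Rightarrow> real"
    and h g :: "nat \<Rightarrow> real^'n \<Rightarrow> real^'r \<Rightarrow> real"
    and p m :: nat
    and \<Xi> N\<^sub>0 :: "(real^'r) set"
    and \<xi>b :: "real^'r" and xb :: "real^'n" and lamb mub :: "nat \<Rightarrow> real"
    and xs :: "real^'r \<Rightarrow> real^'n" and lams mus :: "real^'r \<Rightarrow> nat \<Rightarrow> real"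
  assumes "C2_on (UNIV \<times> \<Xi>) (\<lambda>(x, \<xi>). f x \<xi>)"
    and "\<And>k. k < p \<Longrightarrow> C2_on (UNIV \<times> \<Xi>) (\<lambda>(x, \<xi>). h k x \<xi>)"
    and "\<And>i. i < m \<Longrightarrow> C2_on (UNIV \<times> \<Xi>) (\<lambda>(x, \<xi>). g i x \<xi>)"
    and "\<xi>b \<in> \<Xi>"
    and "regular_minimizer f p h m g xb lamb mub \<xi>b"
    and "N\<^sub>0 \<subseteq> \<Xi>" and "\<xi>b \<in> interior N\<^sub>0"
    and "local_solution_maps f p h m g N\<^sub>0 xs lams mus"
    and "xs \<xi>b = xb"
    and "\<And>k. k < p \<Longrightarrow> lams \<xi>b k = lamb k"
    and "\<And>i. i < m \<Longrightarrow> mus \<xi>b i = mub i"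
    and "strict_compl m g xb mub \<xi>b"
    and "pos_def (hess_xx_lagrangian f p h m g xb lamb mub \<xi>b)"
  shows "\<exists>N. open N \<and> \<xi>b \<in> N \<and> N \<subseteq> N\<^sub>0 \<and>
    C1_on N xs \<and>
    (\<forall>k<p. C1_on N (\<lambda>\<xi>. lams \<xi> k)) \<and>
    (\<forall>i<m. C1_on N (\<lambda>\<xi>. mus \<xi> i)) \<and>
    (\<forall>\<xi>\<in>N.
      let A = to_mat (hess_xx_lagrangian f p h m g (xs \<xi>) (lams \<xi>) (mus \<xi>) \<xi>);
          L = to_mat (hess_\<xi>x_lagrangian f p h m g (xs \<xi>) (lams \<xi>) (mus \<xi>) \<xi>);
          B = constr_jac_x p h m g (xs \<xi>) \<xi>;
          G = constr_jac_\<xi> p h m g (xs \<xi>) \<xi>;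
          S = Sigma_mat A B;
          P = Pi_mat A B
      in invertible_mat A \<and> invertible_mat (B * B\<^sup>T) \<and> invertible_mat (B * minv A * B\<^sup>T) \<and>
         to_mat (jacobian xs (at \<xi>)) = - (P * minv A * L) - S * pinv B * G \<and>
         mult_jac p (active m g (xs \<xi>) \<xi>) lams mus \<xi> =
           - ((pinv B)\<^sup>T * A * S * (minv A * L - pinv B * G)) \<and>
         (\<forall>i\<in>inactive m g (xs \<xi>) \<xi>. grad (\<lambda>\<xi>. mus \<xi> i) \<xi> = 0) \<and>
         (p = 0 \<and> active m g xb \<xi>b = {} \<longrightarrow>
            pinv B * G = 0\<^sub>m CARD('n) CARD('r) \<and>
            S = 0\<^sub>m CARD('n) CARD('n) \<and>
            P = 1\<^sub>m CARD('n)))"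
proof -
  note f_C2 = assms(1) and h_C2 = assms(2) and g_C2 = assms(3)
  define I where "I = active m g xb \<xi>b"
  define J where "J = {..<p} <+> I"
  define c where "c = case_sum h g"
  define \<nu> where "\<nu> \<xi> = case_sum (lams \<xi>) (mus \<xi>)" for \<xi>
  let ?N = "interior N\<^sub>0"
  have I: "I \<subseteq> {..<m}" unfolding I_def active_def by auto
  then have fin_I: "finite I" by (rule finite_subset) simp
  have N_\<Xi>: "?N \<subseteq> \<Xi>" using assms(6) interior_subset by blast
  have N_N0: "?N \<subseteq> N\<^sub>0" by (rule interior_subset)
  have maps: "continuous_on N\<^sub>0 xs" "\<And>k. k < p \<Longrightarrow> continuous_on N\<^sub>0 (\<lambda>\<xi>. lams \<xi> k)"
    "\<And>i. i < m \<Longrightarrow> continuous_on N\<^sub>0 (\<lambda>\<xi>. mus \<xi> i)"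
    "\<And>\<xi>. \<xi> \<in> N\<^sub>0 \<Longrightarrow> licq p h m g (xs \<xi>) \<xi>"
    "\<And>\<xi>. \<xi> \<in> N\<^sub>0 \<Longrightarrow> kkt f p h m g (xs \<xi>) (lams \<xi>) (mus \<xi>) \<xi>"
    using assms(8) unfolding local_solution_maps_def by auto
  have xb: "xb = xs \<xi>b" using assms(9) by simp
  have C2: "C2_on (UNIV \<times> ?N) (\<lambda>(x, \<xi>). f x \<xi>)"
    "\<And>k. k < p \<Longrightarrow> C2_on (UNIV \<times> ?N) (\<lambda>(x, \<xi>). h k x \<xi>)"
    "\<And>i. i < m \<Longrightarrow> C2_on (UNIV \<times> ?N) (\<lambda>(x, \<xi>). g i x \<xi>)"
    using f_C2 h_C2 g_C2 N_\<Xi> by (auto intro: C2_on_subset)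

  have ev_N: "\<forall>\<^sub>F \<xi> in nhds \<xi>b. \<xi> \<in> ?N"
    using assms(7) by (intro eventually_nhds_in_open) auto
  have ev_g: "\<forall>\<^sub>F \<xi> in nhds \<xi>b. g i (xs \<xi>) \<xi> < 0" if i: "i < m" "i \<notin> I" for i
  proof -
    have "continuous_on ?N (\<lambda>\<xi>. case (xs \<xi>, \<xi>) of (x, \<xi>) \<Rightarrow> g i x \<xi>)"
      by (rule continuous_on_compose2[OF C1_on_continuous_on[OF C2_on_imp_C1_on[OF C2(3)[OF i(1)]]]])
         (auto intro!: continuous_intros continuous_on_subset[OF maps(1) N_N0])
    then have "isCont (\<lambda>\<xi>. g i (xs \<xi>) \<xi>) \<xi>b"
      using assms(7) by (simp add: continuous_on_eq_continuous_at)
    then have "((\<lambda>\<xi>. g i (xs \<xi>) \<xi>) \<longlongrightarrow> g i xb \<xi>b) (nhds \<xi>b)"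
      using tendsto_at_iff_tendsto_nhds[of "\<lambda>\<xi>. g i (xs \<xi>) \<xi>" \<xi>b] by (simp add: isCont_def xb)
    moreover have "g i xb \<xi>b < 0"
      using i maps(5)[of \<xi>b] assms(7) N_N0 unfolding kkt_def feasible_def I_def active_def xb by force
    ultimately show ?thesis by (rule order_tendstoD)
  qed
  have ev_mu: "\<forall>\<^sub>F \<xi> in nhds \<xi>b. mus \<xi> i > 0" if i: "i \<in> I" for i
  proof -
    have im: "i < m" using i I by auto
    have "isCont (\<lambda>\<xi>. mus \<xi> i) \<xi>b"
      using continuous_on_subset[OF maps(3)[OF im] N_N0] assms(7) by (simp add: continuous_on_eq_continuous_at)
    then have "((\<lambda>\<xi>. mus \<xi> i) \<longlongrightarrow> mub i) (nhds \<xi>b)"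
      using tendsto_at_iff_tendsto_nhds[of "\<lambda>\<xi>. mus \<xi> i" \<xi>b]
      by (simp add: isCont_def assms(11)[OF im])
    moreover have "mub i > 0"
      using assms(12) i unfolding strict_compl_def I_def by blast
    ultimately show ?thesis by (rule order_tendstoD)
  qed
  have "\<forall>\<^sub>F \<xi> in nhds \<xi>b. \<forall>i\<in>{..<m} - I. g i (xs \<xi>) \<xi> < 0"
    using ev_g by (intro eventually_ball_finite) auto
  moreover have "\<forall>\<^sub>F \<xi> in nhds \<xi>b. \<forall>i\<in>I. mus \<xi> i > 0"
    using ev_mu fin_I by (intro eventually_ball_finite) auto
  ultimately have "\<forall>\<^sub>F \<xi> in nhds \<xi>b. \<xi> \<in> ?N \<and> (\<forall>i\<in>{..<m} - I. g i (xs \<xi>) \<xi> < 0) \<and> (\<forall>i\<in>I. mus \<xi> i > 0)"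
    using ev_N by eventually_elim simp
  \<comment> \<open>On \<open>N\<^sub>1\<close> the active set is constant.\<close>
  then obtain N\<^sub>1 where N1: "open N\<^sub>1" "\<xi>b \<in> N\<^sub>1"
    and N1_props: "\<And>\<xi>. \<xi> \<in> N\<^sub>1 \<Longrightarrow> \<xi> \<in> ?N \<and> (\<forall>i\<in>{..<m} - I. g i (xs \<xi>) \<xi> < 0) \<and> (\<forall>i\<in>I. mus \<xi> i > 0)"
    unfolding eventually_nhds by blast
  have N1_N: "N\<^sub>1 \<subseteq> ?N" using N1_props by blast
  have N1_N0: "N\<^sub>1 \<subseteq> N\<^sub>0" using N1_N N_N0 by blast
  have g_zero: "g i (xs \<xi>) \<xi> = 0" if "\<xi> \<in> N\<^sub>1" "i \<in> I" for \<xi> i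
  proof (rule ccontr)
    assume "g i (xs \<xi>) \<xi> \<noteq> 0"
    moreover have k: "kkt f p h m g (xs \<xi>) (lams \<xi>) (mus \<xi>) \<xi>" using maps(5) that(1) N1_N0 by blast
    moreover have "i < m" using that(2) I by auto
    ultimately have "i \<in> inactive m g (xs \<xi>) \<xi>"
      unfolding kkt_def feasible_def inactive_def by force
    then have "mus \<xi> i = 0" using k unfolding kkt_def by blast
    then show False using N1_props[OF that(1)] that(2) by force
  qed
  have active_I: "active m g (xs \<xi>) \<xi> = I" if "\<xi> \<in> N\<^sub>1" for \<xi>
    using g_zero[OF that] N1_props[OF that] I unfolding active_def by force
  have inactive_I: "inactive m g (xs \<xi>) \<xi> = {..<m} - I" if "\<xi> \<in> N\<^sub>1" for \<xi>
    using g_zero[OF that] N1_props[OF that] unfolding inactive_def by force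
  have mus_zero: "mus \<xi> i = 0" if "\<xi> \<in> N\<^sub>1" "i < m" "i \<notin> I" for \<xi> i
    using maps(5)[of \<xi>] inactive_I[OF that(1)] that N1_N0 unfolding kkt_def by blast
  have C2': "C2_on (UNIV \<times> N\<^sub>1) (\<lambda>(x, \<xi>). f x \<xi>)"
    "\<And>k. k < p \<Longrightarrow> C2_on (UNIV \<times> N\<^sub>1) (\<lambda>(x, \<xi>). h k x \<xi>)"
    "\<And>i. i < m \<Longrightarrow> C2_on (UNIV \<times> N\<^sub>1) (\<lambda>(x, \<xi>). g i x \<xi>)"
    using C2 N1_N by (auto intro: C2_on_subset)
  have lagr: "grad_x_lagrangian f p h m g x (lams \<xi>) (mus \<xi>) \<eta> = lagr_grad f c J (\<nu> \<xi>) (x, \<eta>)"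
    if "\<xi> \<in> N\<^sub>1" "\<eta> \<in> N\<^sub>1" for \<xi> \<eta> x
    unfolding c_def J_def \<nu>_def
    by (rule grad_x_lagrangian_eq[OF N1(1) that(2)]) (use C2' C2_on_imp_C1_on I mus_zero[OF that(1)] in auto)

  \<comment> \<open>Stated for every open subset, since positivity of the Hessian needs a smaller neighbourhood than \<open>N\<^sub>1\<close>.\<close>
  have branch: "kkt_branch f c J M xs \<nu>" if M: "open M" "M \<subseteq> N\<^sub>1" for M
  proof
    have C2M: "C2_on (UNIV \<times> M) (\<lambda>(x, \<xi>). \<phi> x \<xi>)" if "C2_on (UNIV \<times> N\<^sub>1) (\<lambda>(x, \<xi>). \<phi> x \<xi>)"
      for \<phi> :: "real^'n \<Rightarrow> real^'r \<Rightarrow> real"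
      by (rule C2_on_subset[OF that]) (use M(2) in auto)
    have M_N0: "M \<subseteq> N\<^sub>0" using M(2) N1_N0 by blast
    show "finite J" unfolding J_def using fin_I by simp
    show "open M" by (rule M(1))
    show "C2_on (UNIV \<times> M) (\<lambda>(x, \<xi>). f x \<xi>)" by (rule C2M[OF C2'(1)])
    show "C2_on (UNIV \<times> M) (\<lambda>(x, \<xi>). c j x \<xi>)" if "j \<in> J" for j
      using that C2M[OF C2'(2)] C2M[OF C2'(3)] I by (auto simp: J_def c_def)
    show "continuous_on M xs" by (rule continuous_on_subset[OF maps(1) M_N0])
    show "continuous_on M (\<lambda>\<xi>. \<nu> \<xi> j)" if "j \<in> J" for j
      using that I continuous_on_subset[OF maps(2) M_N0] continuous_on_subset[OF maps(3) M_N0]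
      by (auto simp: J_def \<nu>_def)
    fix \<xi> assume "\<xi> \<in> M"
    then have \<xi>: "\<xi> \<in> N\<^sub>1" "\<xi> \<in> N\<^sub>0" using M(2) N1_N0 by auto
    show "lagr_grad f c J (\<nu> \<xi>) (xs \<xi>, \<xi>) = 0"
      using maps(5)[OF \<xi>(2)] lagr[OF \<xi>(1) \<xi>(1)] unfolding kkt_def by simp
    show "c j (xs \<xi>) \<xi> = 0" if "j \<in> J" for j
      using that maps(5)[OF \<xi>(2)] g_zero[OF \<xi>(1)] by (auto simp: J_def c_def kkt_def feasible_def)
    have grads: "case_sum (\<lambda>k. grad (\<lambda>x. h k x \<xi>) (xs \<xi>)) (\<lambda>i. grad (\<lambda>x. g i x \<xi>) (xs \<xi>))
        = (\<lambda>j. grad_x (c j) (xs \<xi>, \<xi>))"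
      by (auto simp: c_def grad_x_def fun_eq_iff split: sum.split)
    show "inj_on (\<lambda>j. grad_x (c j) (xs \<xi>, \<xi>)) J" "independent ((\<lambda>j. grad_x (c j) (xs \<xi>, \<xi>)) ` J)"
      using maps(4)[OF \<xi>(2)] unfolding licq_def Let_def active_I[OF \<xi>(1)] grads J_def by auto
  qed

  define H where "H = kkt_branch.H f c J xs \<nu>"
  note br1 = branch[OF N1(1) subset_refl]
  have hess_xx: "hess_xx_lagrangian f p h m g (xs \<xi>) (lams \<xi>) (mus \<xi>) \<xi> *v u = H \<xi> (u, 0)"
    if \<xi>: "\<xi> \<in> N\<^sub>1" for \<xi> u
    unfolding hess_xx_lagrangian_def lagr[OF \<xi> \<xi>] H_def
    by (rule jacobian_mult[OF has_derivative_partial_x[OF kkt_branch.H_has_derivative[OF br1 \<xi>]]])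
  have hess_\<xi>x: "hess_\<xi>x_lagrangian f p h m g (xs \<xi>) (lams \<xi>) (mus \<xi>) \<xi> *v v = H \<xi> (0, v)"
    if \<xi>: "\<xi> \<in> N\<^sub>1" for \<xi> v
    unfolding hess_\<xi>x_lagrangian_def H_def
    by (rule jacobian_mult, rule has_derivative_transform_within_open[OF
          has_derivative_partial_\<xi>[OF kkt_branch.H_has_derivative[OF br1 \<xi>]] N1(1) \<xi>])
       (simp add: lagr[OF \<xi>])
  have "lagrangian f p h m g x lamb mub \<xi>b = lagrangian f p h m g x (lams \<xi>b) (mus \<xi>b) \<xi>b" for x
    by (simp add: lagrangian_def assms(10,11))
  then have "hess_xx_lagrangian f p h m g xb lamb mub \<xi>b
      = hess_xx_lagrangian f p h m g (xs \<xi>b) (lams \<xi>b) (mus \<xi>b) \<xi>b"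
    by (simp add: hess_xx_lagrangian_def grad_x_lagrangian_def xb)
  then have pos_b: "u \<bullet> H \<xi>b (u, 0) > 0" if "u \<noteq> 0" for u
    using assms(13) that hess_xx[OF N1(2)] unfolding pos_def_def by simp
  obtain N where N: "open N" "\<xi>b \<in> N" "N \<subseteq> N\<^sub>1"
    and pos: "\<And>\<xi> u. \<xi> \<in> N \<Longrightarrow> u \<noteq> 0 \<Longrightarrow> u \<bullet> H \<xi> (u, 0) > 0"
    using positive_on_neighborhood[OF N1 kkt_branch.continuous_on_H[OF br1], folded H_def, OF pos_b] by blast
  note br = branch[OF N(1,3)]
  have xs_C1: "C1_on N xs" and \<nu>_C1: "\<And>j. j \<in> J \<Longrightarrow> C1_on N (\<lambda>\<xi>. \<nu> \<xi> j)"
    using kkt_branch.x_C1[OF br, folded H_def, OF pos] kkt_branch.\<nu>_C1[OF br, folded H_def, OF pos] by auto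
  have lams_C1: "C1_on N (\<lambda>\<xi>. lams \<xi> k)" if "k < p" for k
    using \<nu>_C1[of "Inl k"] that by (auto simp: J_def \<nu>_def)
  have mus_C1: "C1_on N (\<lambda>\<xi>. mus \<xi> i)" if "i < m" for i
  proof (cases "i \<in> I")
    case True
    then show ?thesis using \<nu>_C1[of "Inr i"] by (auto simp: J_def \<nu>_def)
  next
    case False
    show ?thesis
      by (rule C1_on_cong[OF C1_on_const[of N 0]]) (use mus_zero[OF _ that False] N(3) in auto)
  qed
  have grad_mus: "grad (\<lambda>\<xi>. mus \<xi> i) \<xi> = 0" if "\<xi> \<in> N" "i \<in> inactive m g (xs \<xi>) \<xi>" for \<xi> i
  proof -
    have i: "i < m" "i \<notin> I" using that inactive_I N(3) by auto
    have "((\<lambda>\<xi>. mus \<xi> i) has_derivative (\<lambda>v. 0)) (at \<xi>)"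
      by (rule has_derivative_transform_within_open[OF has_derivative_const N(1) that(1), of 0])
         (use mus_zero[OF _ i] N(3) in auto)
    from grad_inner[OF this, of "grad (\<lambda>\<xi>. mus \<xi> i) \<xi>"] show ?thesis by simp
  qed

  \<comment> \<open>The row order of the constraint Jacobians: equality constraints first, then \<open>I\<close> increasingly.\<close>
  define js where "js = map Inl [0..<p] @ map Inr (sorted_list_of_set I)"
  have js: "distinct js" "set js = J"
    unfolding js_def J_def using fin_I by (auto simp: distinct_map)
  show ?thesis
  proof (intro exI[of _ N] conjI allI impI ballI)
    show "open N" "\<xi>b \<in> N" "C1_on N xs" by fact+
    show "N \<subseteq> N\<^sub>0" using N(3) N1_N0 by blast
    show "C1_on N (\<lambda>\<xi>. lams \<xi> k)" if "k < p" for k by (rule lams_C1[OF that])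
    show "C1_on N (\<lambda>\<xi>. mus \<xi> i)" if "i < m" for i by (rule mus_C1[OF that])
    fix \<xi> assume \<xi>N: "\<xi> \<in> N"
    then have \<xi>: "\<xi> \<in> N\<^sub>1" using N(3) by auto
    define A' where "A' = hess_xx_lagrangian f p h m g (xs \<xi>) (lams \<xi>) (mus \<xi>) \<xi>"
    define L' where "L' = hess_\<xi>x_lagrangian f p h m g (xs \<xi>) (lams \<xi>) (mus \<xi>) \<xi>"
    define B where "B = constr_jac_x p h m g (xs \<xi>) \<xi>"
    define G where "G = constr_jac_\<xi> p h m g (xs \<xi>) \<xi>"
    define V where "V = mult_jac p (active m g (xs \<xi>) \<xi>) lams mus \<xi>"
    have A': "A' *v u = H \<xi> (u, 0)" and L': "L' *v v = H \<xi> (0, v)" for u v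
      unfolding A'_def L'_def by (rule hess_xx[OF \<xi>], rule hess_\<xi>x[OF \<xi>])
    have pd: "pos_def A'" unfolding pos_def_def A' using pos[OF \<xi>N] by blast
    have B: "B = mat_of_row_list (map (\<lambda>j. grad_x (c j) (xs \<xi>, \<xi>)) js)"
      by (simp add: B_def constr_jac_x_def active_I[OF \<xi>] js_def c_def grad_x_def comp_def)
    have G: "G = mat_of_row_list (map (\<lambda>j. grad (\<lambda>\<eta>. c j (xs \<xi>) \<eta>) \<xi>) js)"
      by (simp add: G_def constr_jac_\<xi>_def active_I[OF \<xi>] js_def c_def comp_def)
    have V: "V = mat_of_row_list (map (\<lambda>j. grad (\<lambda>\<eta>. \<nu> \<eta> j) \<xi>) js)"
      by (simp add: V_def mult_jac_def active_I[OF \<xi>] js_def \<nu>_def comp_def)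
    note solution = kkt_branch.kkt_branch_formulas[OF br xs_C1 \<nu>_C1 \<xi>N js, folded H_def, OF _ A' L' pd B G V]
    have formulas: "invertible_mat (to_mat A')" "invertible_mat (B * B\<^sup>T)"
      "invertible_mat (B * minv (to_mat A') * B\<^sup>T)"
      "to_mat (jacobian xs (at \<xi>)) =
        - (Pi_mat (to_mat A') B * minv (to_mat A') * to_mat L') - Sigma_mat (to_mat A') B * pinv B * G"
      "V = - ((pinv B)\<^sup>T * to_mat A' * Sigma_mat (to_mat A') B * (minv (to_mat A') * to_mat L' - pinv B * G))"
      by (rule solution; assumption)+
    have none: "pinv B * G = 0\<^sub>m CARD('n) CARD('r) \<and> Sigma_mat (to_mat A') B = 0\<^sub>m CARD('n) CARD('n) \<and>
        Pi_mat (to_mat A') B = 1\<^sub>m CARD('n)" if "p = 0 \<and> active m g xb \<xi>b = {}"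
    proof -
      have "js = []" using that by (simp add: js_def I_def)
      then have "B \<in> carrier_mat 0 CARD('n)" "G \<in> carrier_mat 0 CARD('r)"
        unfolding B G by (simp_all add: mat_of_row_list_def)
      from no_constraints_mats[OF to_mat_carrier this formulas(1-3)] show ?thesis by blast
    qed
    show "let A = to_mat (hess_xx_lagrangian f p h m g (xs \<xi>) (lams \<xi>) (mus \<xi>) \<xi>);
          L = to_mat (hess_\<xi>x_lagrangian f p h m g (xs \<xi>) (lams \<xi>) (mus \<xi>) \<xi>);
          B = constr_jac_x p h m g (xs \<xi>) \<xi>;
          G = constr_jac_\<xi> p h m g (xs \<xi>) \<xi>;
          S = Sigma_mat A B;
          P = Pi_mat A B
      in invertible_mat A \<and> invertible_mat (B * B\<^sup>T) \<and> invertible_mat (B * minv A * B\<^sup>T) \<and>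
         to_mat (jacobian xs (at \<xi>)) = - (P * minv A * L) - S * pinv B * G \<and>
         mult_jac p (active m g (xs \<xi>) \<xi>) lams mus \<xi> =
           - ((pinv B)\<^sup>T * A * S * (minv A * L - pinv B * G)) \<and>
         (\<forall>i\<in>inactive m g (xs \<xi>) \<xi>. grad (\<lambda>\<xi>. mus \<xi> i) \<xi> = 0) \<and>
         (p = 0 \<and> active m g xb \<xi>b = {} \<longrightarrow>
            pinv B * G = 0\<^sub>m CARD('n) CARD('r) \<and>
            S = 0\<^sub>m CARD('n) CARD('n) \<and>
            P = 1\<^sub>m CARD('n))"
      unfolding Let_def A'_def[symmetric] L'_def[symmetric] B_def[symmetric] G_def[symmetric] V_def[symmetric]
      using formulas grad_mus[OF \<xi>N] none by blast
  qed
qed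

end
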